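(* The loop simplicial group $\Omega(\mathrm{AP}_* )$ of the simplicial group $\mathrm{AP}_*$ of pure braid groups is isomorphic, as a simplicial group, to Milnor's free simplicial group $F[\Delta[1]]$ on the simplicial $1$-simplex $\Delta[1]$.
   Context: Let $B_m$ be Artin's braid group on $m$ strands with standard generators $\sigma_1,\dots,\sigma_{m-1}$, and $P_m$ the pure braid group (kernel of $B_m\to\Sigma_m$). $P_m$ is generated by $A_{r,s}=\alpha\,\sigma_r^2\,\alpha^{-1}$ with $\alpha=\sigma_{s-1}\sigma_{s-2}\cdots\sigma_{r+1}$, $1\le r<s\le m$. The simplicial group $\mathrm{AP}_*$ is $P_{n+1}$ in degree $n$; the face $d_t$ ($0\le t\le n$) deletes the $(t+1)$-st strand and the degeneracy $s_t$ ($0\le t\le n$) doubles the $(t+1)$-st strand. Explicitly, $d_t(A_{i,j})=A_{i-1,j-1}$ if $t+1<i$; $1$ if $t+1=i$; $A_{i,j-1}$ if $i<t+1<j$; $1$ if $t+1=j$; $A_{i,j}$ if $t+1>j$. And $s_t(A_{i,j})=A_{i+1,j+1}$ if $t+1<i$; $A_{i,j+1}A_{i+1,j+1}$ if $t+1=i$; $A_{i,j+1}$ if $i<t+1<j$; $A_{i,j}A_{i,j+1}$ if $t+1=j$; $A_{i,j}$ if $t+1>j$. For a pointed simplicial set $K$ with base-point $*\in K_0$, $F[K]$ is the simplicial group which in degree $n$ is the free group generated by $K_n$ modulo the single relation $s_0^n( * )=1$, with faces and degeneracies induced from $K$. $\Delta[1]$ has $n$-simplices $\langle 0^i,1^{n+1-i}\rangle$,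 $0\le i\le n+1$, and base-point $\langle 0\rangle$. For a reduced simplicial group $\Gamma_*$ (that is, $\Gamma_0$ trivial), the loop simplicial group $\Omega\Gamma_*$ (Moore) is, in degree $n$, $\ker[d_0:\Gamma_{n+1}\to\Gamma_n]$, with faces and degeneracies those of $\Gamma_*$ shifted by one: $d_i$ and $s_i$ on $(\Omega\Gamma)_n$ are the restrictions of $d_{i+1}$ and $s_{i+1}$ on $\Gamma_{n+1}$. *)

theory Defs
  imports "HOL-Algebra.Sym_Groups"
begin

section \<open>Groups given by generators and relations\<close>

text \<open>The letter \<open>(x, True)\<close> stands for the generator \<open>x\<close> and \<open>(x, False)\<close> for its inverse.\<close>

type_synonym 'a word = "('a \<times> bool) list"

definition words :: "'a set \<Rightarrow> 'a word set" where
  "words X = lists (X \<times> UNIV)"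

inductive pres_eq :: "'a set \<Rightarrow> ('a word \<times> 'a word) set \<Rightarrow> 'a word \<Rightarrow> 'a word \<Rightarrow> bool"
  for X :: "'a set" and R :: "('a word \<times> 'a word) set"
where
  refl: "w \<in> words X \<Longrightarrow> pres_eq X R w w"
| sym: "pres_eq X R v w \<Longrightarrow> pres_eq X R w v"
| trans: "pres_eq X R u v \<Longrightarrow> pres_eq X R v w \<Longrightarrow> pres_eq X R u w"
| append: "pres_eq X R u u' \<Longrightarrow> pres_eq X R v v' \<Longrightarrow> pres_eq X R (u @ v) (u' @ v')"
| cancel: "x \<in> X \<Longrightarrow> pres_eq X R [(x, b), (x, \<not> b)] []"
| relation: "(l, r) \<in> R \<Longrightarrow> l \<in> words X \<Longrightarrow> r \<in> words X \<Longrightarrow> pres_eq X R l r"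

definition pres_rel :: "'a set \<Rightarrow> ('a word \<times> 'a word) set \<Rightarrow> ('a word \<times> 'a word) set" where
  "pres_rel X R = {(v, w). pres_eq X R v w}"

definition pres_group :: "'a set \<Rightarrow> ('a word \<times> 'a word) set \<Rightarrow> 'a word set monoid" where
  "pres_group X R =
     \<lparr>carrier = words X // pres_rel X R,
      mult = (\<lambda>C D. \<Union>v\<in>C. \<Union>w\<in>D. pres_rel X R `` {v @ w}),
      one = pres_rel X R `` {[]}\<rparr>"


section \<open>Braid groups and pure braid groups\<close>

text \<open>The generator \<open>\<sigma>\<^sub>i\<close> of the braid group on \<open>m\<close> strands is encoded by \<open>i \<in> {1..<m}\<close>.\<close>

definition braid_relations :: "nat \<Rightarrow> (nat word \<times> nat word) set" where
  "braid_relations m =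
     {([(i, True), (j, True)], [(j, True), (i, True)]) | i j.
        i \<in> {1..<m} \<and> j \<in> {1..<m} \<and> i + 2 \<le> j} \<union>
     {([(i, True), (Suc i, True), (i, True)], [(Suc i, True), (i, True), (Suc i, True)]) | i.
        i \<in> {1..<m} \<and> Suc i \<in> {1..<m}}"

definition braid_group :: "nat \<Rightarrow> nat word set monoid" where
  "braid_group m = pres_group {1..<m} (braid_relations m)"

abbreviation braid_eq :: "nat \<Rightarrow> nat word \<Rightarrow> nat word \<Rightarrow> bool" where
  "braid_eq m \<equiv> pres_eq {1..<m} (braid_relations m)"

definition braid_class :: "nat \<Rightarrow> nat word \<Rightarrow> nat word set" where
  "braid_class m w = pres_rel {1..<m} (braid_relations m) `` {w}"

fun word_perm :: "nat word \<Rightarrow> nat \<Rightarrow> nat" where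
  "word_perm [] = id"
| "word_perm ((i, b) # w) = transpose i (Suc i) \<circ> word_perm w"

definition braid_perm :: "nat word set \<Rightarrow> nat \<Rightarrow> nat" where
  "braid_perm C = the_elem (word_perm ` C)"

definition pure_braid_group :: "nat \<Rightarrow> nat word set monoid" where
  "pure_braid_group m =
     (braid_group m)\<lparr>carrier := kernel (braid_group m) (sym_group m) braid_perm\<rparr>"

text \<open>The word \<open>\<alpha> \<sigma>\<^sub>r\<^sup>2 \<alpha>\<^sup>-\<^sup>1\<close> with \<open>\<alpha> = \<sigma>\<^bsub>s-1\<^esub> \<dots> \<sigma>\<^bsub>r+1\<^esub>\<close>, representing \<open>A\<^bsub>r,s\<^esub>\<close>.\<close>

definition pure_gen :: "nat \<Rightarrow> nat \<Rightarrow> nat word" where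
  "pure_gen r s =
     map (\<lambda>k. (k, True)) (rev [Suc r..<s]) @ [(r, True), (r, True)] @
     map (\<lambda>k. (k, False)) [Suc r..<s]"


section \<open>Deleting and doubling a strand\<close>

text \<open>
  A word is read from left to right, and \<open>p\<close> is the position, before the first remaining
  letter, of the strand that is deleted or doubled.  A crossing of the strands in positions
  \<open>i\<close> and \<open>i + 1\<close> moves the strand if \<open>p = i\<close> or \<open>p = i + 1\<close>.  Doubling replaces such a crossing
  by the two crossings of the two parallel strands with the other strand.
\<close>

fun delete_strand :: "nat \<Rightarrow> nat word \<Rightarrow> nat word" where
  "delete_strand p [] = []"
| "delete_strand p ((i, b) # w) =
     (if p < i then (i - 1, b) # delete_strand p w
      else if p = i then delete_strand (Suc i) w
      else if p = Suc i then delete_strand i w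
      else (i, b) # delete_strand p w)"

fun double_strand :: "nat \<Rightarrow> nat word \<Rightarrow> nat word" where
  "double_strand p [] = []"
| "double_strand p ((i, b) # w) =
     (if p < i then (Suc i, b) # double_strand p w
      else if p = i then [(Suc i, b), (i, b)] @ double_strand (Suc i) w
      else if p = Suc i then [(i, b), (Suc i, b)] @ double_strand i w
      else (i, b) # double_strand p w)"


section \<open>Simplicial sets and simplicial groups\<close>

text \<open>
  \<open>d n i\<close> is the face operator \<open>d\<^sub>i\<close> from degree \<open>n\<close> to degree \<open>n - 1\<close>, used for \<open>n \<ge> 1\<close>, and
  \<open>s n i\<close> is the degeneracy operator \<open>s\<^sub>i\<close> from degree \<open>n\<close> to degree \<open>n + 1\<close>.
\<close>

definition simplicial ::
  "(nat \<Rightarrow> 'a set) \<Rightarrow> (nat \<Rightarrow> nat \<Rightarrow> 'a \<Rightarrow> 'a) \<Rightarrow> (nat \<Rightarrow> nat \<Rightarrow> 'a \<Rightarrow> 'a) \<Rightarrow> bool" where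
  "simplicial X d s \<longleftrightarrow>
     (\<forall>n. \<forall>i\<le>Suc n. \<forall>x\<in>X (Suc n). d (Suc n) i x \<in> X n) \<and>
     (\<forall>n. \<forall>i\<le>n. \<forall>x\<in>X n. s n i x \<in> X (Suc n)) \<and>
     (\<forall>n. \<forall>j\<le>Suc (Suc n). \<forall>i<j. \<forall>x\<in>X (Suc (Suc n)).
        d (Suc n) i (d (Suc (Suc n)) j x) = d (Suc n) (j - 1) (d (Suc (Suc n)) i x)) \<and>
     (\<forall>n. \<forall>j\<le>n. \<forall>i<j. \<forall>x\<in>X n.
        d (Suc n) i (s n j x) = s (n - 1) (j - 1) (d n i x)) \<and>
     (\<forall>n. \<forall>j\<le>n. \<forall>x\<in>X n.
        d (Suc n) j (s n j x) = x \<and> d (Suc n) (Suc j) (s n j x) = x) \<and>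
     (\<forall>n. \<forall>i\<le>Suc n. \<forall>j. Suc j < i \<longrightarrow> (\<forall>x\<in>X n.
        d (Suc n) i (s n j x) = s (n - 1) j (d n (i - 1) x))) \<and>
     (\<forall>n. \<forall>j\<le>n. \<forall>i\<le>j. \<forall>x\<in>X n.
        s (Suc n) i (s n j x) = s (Suc n) (Suc j) (s n i x))"

record 'a pointed_sset =
  simplices :: "nat \<Rightarrow> 'a set"
  sface :: "nat \<Rightarrow> nat \<Rightarrow> 'a \<Rightarrow> 'a"
  sdegen :: "nat \<Rightarrow> nat \<Rightarrow> 'a \<Rightarrow> 'a"
  basept :: 'a

definition pointed_simplicial_set :: "'a pointed_sset \<Rightarrow> bool" where
  "pointed_simplicial_set K \<longleftrightarrow>
     simplicial (simplices K) (sface K) (sdegen K) \<and> basept K \<in> simplices K 0"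

record 'a sgroup =
  grp :: "nat \<Rightarrow> 'a monoid"
  gface :: "nat \<Rightarrow> nat \<Rightarrow> 'a \<Rightarrow> 'a"
  gdegen :: "nat \<Rightarrow> nat \<Rightarrow> 'a \<Rightarrow> 'a"

definition simplicial_group :: "'a sgroup \<Rightarrow> bool" where
  "simplicial_group G \<longleftrightarrow>
     (\<forall>n. group (grp G n)) \<and>
     (\<forall>n. \<forall>i\<le>Suc n. gface G (Suc n) i \<in> hom (grp G (Suc n)) (grp G n)) \<and>
     (\<forall>n. \<forall>i\<le>n. gdegen G n i \<in> hom (grp G n) (grp G (Suc n))) \<and>
     simplicial (\<lambda>n. carrier (grp G n)) (gface G) (gdegen G)"

definition simplicial_group_isomorphic :: "'a sgroup \<Rightarrow> 'b sgroup \<Rightarrow> bool" where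
  "simplicial_group_isomorphic G H \<longleftrightarrow>
     simplicial_group G \<and> simplicial_group H \<and>
     (\<exists>\<phi>. (\<forall>n. \<phi> n \<in> iso (grp G n) (grp H n)) \<and>
       (\<forall>n. \<forall>i\<le>Suc n. \<forall>x\<in>carrier (grp G (Suc n)).
          \<phi> n (gface G (Suc n) i x) = gface H (Suc n) i (\<phi> (Suc n) x)) \<and>
       (\<forall>n. \<forall>i\<le>n. \<forall>x\<in>carrier (grp G n).
          \<phi> (Suc n) (gdegen G n i x) = gdegen H n i (\<phi> n x)))"

definition reduced :: "'a sgroup \<Rightarrow> bool" where
  "reduced G \<longleftrightarrow> carrier (grp G 0) = {\<one>\<^bsub>grp G 0\<^esub>}"

definition loop_sgroup :: "'a sgroup \<Rightarrow> 'a sgroup" where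
  "loop_sgroup G =
     \<lparr>grp = (\<lambda>n. (grp G (Suc n))
        \<lparr>carrier := kernel (grp G (Suc n)) (grp G n) (gface G (Suc n) 0)\<rparr>),
      gface = (\<lambda>n i. gface G (Suc n) (Suc i)),
      gdegen = (\<lambda>n i. gdegen G (Suc n) (Suc i))\<rparr>"


section \<open>The simplicial group of pure braid groups\<close>

definition AP :: "nat word set sgroup" where
  "AP =
     \<lparr>grp = (\<lambda>n. pure_braid_group (Suc n)),
      gface = (\<lambda>n t C. \<Union>w\<in>C. braid_class n (delete_strand (Suc t) w)),
      gdegen = (\<lambda>n t C. \<Union>w\<in>C. braid_class (n + 2) (double_strand (Suc t) w))\<rparr>"

lemma pres_eq_words: "pres_eq X R v w \<Longrightarrow> v \<in> words X \<and> w \<in> words X"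
  by (induction rule: pres_eq.induct) (auto simp: words_def)

lemma reduced_AP: "reduced AP"
proof -
  have w: "words {} = {[]}"
    by (auto simp: words_def)
  have c: "carrier (braid_group 1) = {\<one>\<^bsub>braid_group 1\<^esub>}"
    by (simp add: braid_group_def pres_group_def w quotient_def)
  have "\<one>\<^bsub>braid_group 1\<^esub> = {[]}"
    using pres_eq_words[of "{}" "braid_relations (Suc 0)"]
    by (auto simp: braid_group_def pres_group_def pres_rel_def w intro: pres_eq.refl)
  then have "braid_perm (\<one>\<^bsub>braid_group 1\<^esub>) = \<one>\<^bsub>sym_group 1\<^esub>"
    by (simp add: braid_perm_def sym_group_def)
  with c show ?thesis
    by (auto simp: reduced_def AP_def pure_braid_group_def kernel_def)
qed


section \<open>Milnor's free simplicial group\<close>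

text \<open>The degenerate simplex \<open>s\<^sub>0\<^sup>n(*)\<close>.\<close>

primrec base_simplex :: "'a pointed_sset \<Rightarrow> nat \<Rightarrow> 'a" where
  "base_simplex K 0 = basept K"
| "base_simplex K (Suc n) = sdegen K n 0 (base_simplex K n)"

definition milnor_rel :: "'a pointed_sset \<Rightarrow> nat \<Rightarrow> ('a word \<times> 'a word) set" where
  "milnor_rel K n = {([(base_simplex K n, True)], [])}"

definition milnor_class :: "'a pointed_sset \<Rightarrow> nat \<Rightarrow> 'a word \<Rightarrow> 'a word set" where
  "milnor_class K n w = pres_rel (simplices K n) (milnor_rel K n) `` {w}"

definition milnor_F :: "'a pointed_sset \<Rightarrow> 'a word set sgroup" where
  "milnor_F K =
     \<lparr>grp = (\<lambda>n. pres_group (simplices K n) (milnor_rel K n)),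
      gface = (\<lambda>n i C. \<Union>w\<in>C. milnor_class K (n - 1) (map (\<lambda>(x, b). (sface K n i x, b)) w)),
      gdegen = (\<lambda>n i C. \<Union>w\<in>C. milnor_class K (Suc n) (map (\<lambda>(x, b). (sdegen K n i x, b)) w))\<rparr>"

text \<open>
  An \<open>n\<close>-simplex of \<open>\<Delta>[1]\<close> is the list of its \<open>n + 1\<close> vertices; \<open>d\<^sub>i\<close> omits and \<open>s\<^sub>i\<close> repeats the
  vertex with index \<open>i\<close>.
\<close>

definition Delta1 :: "nat list pointed_sset" where
  "Delta1 =
     \<lparr>simplices = (\<lambda>n. {replicate i 0 @ replicate (n + 1 - i) 1 | i. i \<le> n + 1}),
      sface = (\<lambda>n i x. take i x @ drop (Suc i) x),
      sdegen = (\<lambda>n i x. take (Suc i) x @ drop i x),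
      basept = [0]\<rparr>"

lemma Delta1_simplex_iff:
  "x \<in> simplices Delta1 n \<longleftrightarrow> length x = Suc n \<and> sorted x \<and> set x \<subseteq> {0, 1}"
proof
  assume "x \<in> simplices Delta1 n"
  then show "length x = Suc n \<and> sorted x \<and> set x \<subseteq> {0, 1}"
    by (auto simp: Delta1_def sorted_append sorted_replicate split: if_splits)
next
  have aux: "\<exists>i\<le>length x. x = replicate i 0 @ replicate (length x - i) 1"
    if "sorted x" "set x \<subseteq> {0, 1}" for x :: "nat list"
    using that
  proof (induction x)
    case (Cons a x)
    then obtain i where i: "i \<le> length x" "x = replicate i 0 @ replicate (length x - i) 1"
      by auto
    show ?case
    proof (cases "a = 0")
      case True
      then show ?thesis using i by (intro exI[of _ "Suc i"]) auto
    next
      case False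
      then have "a = 1" "\<forall>y\<in>set x. y = 1" using Cons.prems by fastforce+
      then have "a # x = replicate (length (a # x)) 1"
        by (auto simp: replicate_length_same)
      then show ?thesis by (intro exI[of _ 0]) auto
    qed
  qed simp
  assume "length x = Suc n \<and> sorted x \<and> set x \<subseteq> {0, 1}"
  with aux[of x] show "x \<in> simplices Delta1 n" by (auto simp: Delta1_def)
qed

lemma pointed_simplicial_set_Delta1: "pointed_simplicial_set Delta1"
proof -
  have f: "sface Delta1 n i x = take i x @ drop (Suc i) x" for n i x
    by (simp add: Delta1_def)
  have s: "sdegen Delta1 n i x = take (Suc i) x @ drop i x" for n i x
    by (simp add: Delta1_def)
  have mono: "x ! k \<le> x ! l" if "sorted x" "k \<le> l" "l < length x" for x :: "nat list" and k l
    using that by (simp add: sorted_nth_mono)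
  have F: "sface Delta1 (Suc n) i x \<in> simplices Delta1 n"
    if "x \<in> simplices Delta1 (Suc n)" "i \<le> Suc n" for n i x
  proof -
    have "sorted (take i x @ drop (Suc i) x)"
      using that by (auto simp: Delta1_simplex_iff sorted_iff_nth_mono nth_append min_def)
    then show ?thesis
      using that set_take_subset[of i x] set_drop_subset[of "Suc i" x]
      by (auto simp: Delta1_simplex_iff f)
  qed
  have S: "sdegen Delta1 n i x \<in> simplices Delta1 (Suc n)"
    if "x \<in> simplices Delta1 n" "i \<le> n" for n i x
  proof -
    have "sorted (take (Suc i) x @ drop i x)"
      using that by (auto simp: Delta1_simplex_iff sorted_iff_nth_mono nth_append min_def)
    then show ?thesis
      using that set_take_subset[of "Suc i" x] set_drop_subset[of i x]
      by (auto simp: Delta1_simplex_iff s)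
  qed
  have L: "length x = Suc n" if "x \<in> simplices Delta1 n" for x n
    using that by (simp add: Delta1_simplex_iff)
  show ?thesis
    unfolding pointed_simplicial_set_def simplicial_def
    apply (intro conjI allI impI ballI)
    subgoal using F by simp
    subgoal using S by simp
    subgoal by (auto dest!: L simp: f nth_append min_def intro!: nth_equalityI)
    subgoal by (auto dest!: L simp: f s nth_append min_def intro!: nth_equalityI split: if_splits)
    subgoal by (auto dest!: L simp: f s nth_append min_def intro!: nth_equalityI split: if_splits)
    subgoal by (auto dest!: L simp: f s nth_append min_def intro!: nth_equalityI split: if_splits)
    subgoal by (auto dest!: L simp: f s nth_append min_def intro!: nth_equalityI split: if_splits)
    subgoal by (auto dest!: L simp: f s nth_append min_def intro!: nth_equalityI split: if_splits)
        (rule arg_cong[where f = "nth _"], linarith)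
    subgoal by (auto simp: Delta1_def intro!: exI[of _ 1])
    done
qed


section \<open>Explicit formulas for the faces and degeneracies of \<open>A\<^bsub>i,j\<^esub>\<close>\<close>

lemma pure_gen_base: "pure_gen r (Suc r) = [(r, True), (r, True)]"
  by (simp add: pure_gen_def)

lemma pure_gen_step: "r < s \<Longrightarrow> pure_gen r (Suc s) = (s, True) # pure_gen r s @ [(s, False)]"
  by (simp add: pure_gen_def)

lemma words_Cons: "(i, b) # w \<in> words X \<longleftrightarrow> i \<in> X \<and> w \<in> words X"
  by (simp add: words_def)

lemma words_Nil: "[] \<in> words X"
  by (simp add: words_def)

lemma words_append: "v @ w \<in> words X \<longleftrightarrow> v \<in> words X \<and> w \<in> words X"
  by (simp add: words_def)

lemmas words_simps = words_Nil words_Cons words_append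

lemma pure_gen_words: "1 \<le> r \<Longrightarrow> r < s \<Longrightarrow> s \<le> m \<Longrightarrow> pure_gen r s \<in> words {1..<m}"
  by (auto simp: pure_gen_def words_def)

lemma pres_eq_context:
  assumes "pres_eq X R v w" "a \<in> words X" "b \<in> words X"
  shows "pres_eq X R (a @ v @ b) (a @ w @ b)"
  using assms by (intro pres_eq.append pres_eq.refl)

lemma cancel_context:
  assumes "x \<in> X" "a \<in> words X" "b \<in> words X"
  shows "pres_eq X R (a @ (x, c) # (x, \<not> c) # b) (a @ b)"
  using pres_eq_context[OF pres_eq.cancel[OF assms(1), of R c] assms(2,3)] by simp

fun track :: "nat \<Rightarrow> nat word \<Rightarrow> nat" where
  "track p [] = p"
| "track p ((i, b) # w) = track (if p = i then Suc i else if p = Suc i then i else p) w"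

lemma delete_strand_append:
  "delete_strand p (u @ v) = delete_strand p u @ delete_strand (track p u) v"
  by (induction p u rule: delete_strand.induct) auto

lemma double_strand_append:
  "double_strand p (u @ v) = double_strand p u @ double_strand (track p u) v"
  by (induction p u rule: double_strand.induct) auto

lemma track_append: "track p (u @ v) = track (track p u) v"
  by (induction p u rule: track.induct) auto

lemma track_pure_gen: "r < s \<Longrightarrow> track p (pure_gen r s) = p"
proof (induction s arbitrary: p)
  case (Suc s)
  then show ?case
    by (cases "s = r") (simp_all add: pure_gen_base pure_gen_step track_append)
qed simp

lemma delete_strand_pure_gen_exact:
  assumes "1 \<le> r" "r < s" "p \<noteq> r"
  shows "delete_strand p (pure_gen r s) =
    (if p < r then pure_gen (r - 1) (s - 1) else if p < s then pure_gen r (s - 1)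
     else if p = s then [] else pure_gen r s)"
  using assms
proof (induction s arbitrary: p)
  case (Suc s)
  show ?case
  proof (cases "s = r")
    case True
    then show ?thesis using Suc.prems pure_gen_base[of "r - 1"] by (auto simp: pure_gen_base)
  next
    case False
    then have s: "r < s" using Suc.prems by simp
    have step: "pure_gen r s = (s - 1, True) # pure_gen r (s - 1) @ [(s - 1, False)]"
      if "r < p" "p < s"
      using pure_gen_step[of r "s - 1"] that by simp
    have step': "pure_gen (r - 1) s = (s - 1, True) # pure_gen (r - 1) (s - 1) @ [(s - 1, False)]"
      using pure_gen_step[of "r - 1" "s - 1"] s Suc.prems by simp
    consider "p < r" | "r < p" "p < s" | "p = s" | "p = Suc s" | "Suc s < p"
      using Suc.prems by linarith
    then show ?thesis
      using Suc.prems s Suc.IH[of p] Suc.IH[of "Suc s"] Suc.IH[of s]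
      by cases (simp_all add: pure_gen_step delete_strand_append track_pure_gen step[symmetric] step'[symmetric]
          del: One_nat_def)
  qed
qed simp

lemma delete_strand_pure_gen_same:
  assumes "1 \<le> r" "r < s" "s \<le> Suc m"
  shows "braid_eq m (delete_strand r (pure_gen r s)) []"
  using assms
proof (induction s)
  case (Suc s)
  show ?case
  proof (cases "s = r")
    case True
    then show ?thesis by (simp add: pure_gen_base pres_eq.refl words_simps)
  next
    case False
    then have s: "r < s" "s - 1 \<in> {1..<m}" using Suc.prems by auto
    have "braid_eq m (delete_strand r (pure_gen r s)) []"
      using Suc s by simp
    from pres_eq_context[OF this, of "[(s - 1, True)]" "[(s - 1, False)]"]
    have "braid_eq m (delete_strand r (pure_gen r (Suc s))) [(s - 1, True), (s - 1, False)]"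
      using s by (simp add: pure_gen_step delete_strand_append track_pure_gen words_simps)
    then show ?thesis
      using pres_eq.cancel[OF s(2), of "braid_relations m" True] by (auto intro: pres_eq.trans)
  qed
qed simp

lemma double_strand_pure_gen_exact:
  assumes "r < s" "p \<noteq> r" "p \<noteq> s"
  shows "double_strand p (pure_gen r s) =
    (if p < r then pure_gen (Suc r) (Suc s) else if p < s then pure_gen r (Suc s)
     else pure_gen r s)"
  using assms
proof (induction s arbitrary: p)
  case (Suc s)
  show ?case
  proof (cases "s = r")
    case True
    then show ?thesis using Suc.prems by (auto simp: pure_gen_base)
  next
    case False
    then have s: "r < s" using Suc.prems by simp
    then have "double_strand (Suc s) (pure_gen r s) = pure_gen r s"
      using Suc.IH[of "Suc s"] by simp
    consider "p < r" | "r < p" "p < s" | "p = s" | "Suc s < p"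
      using Suc.prems by linarith
    then show ?thesis
      using Suc.prems s Suc.IH[of p] \<open>double_strand (Suc s) (pure_gen r s) = pure_gen r s\<close>
      by cases (simp_all add: pure_gen_step double_strand_append track_pure_gen)
  qed
qed simp

lemma double_strand_pure_gen_left:
  assumes "1 \<le> r" "r < s" "s \<le> m"
  shows "braid_eq (Suc m) (double_strand r (pure_gen r s))
    (pure_gen r (Suc s) @ pure_gen (Suc r) (Suc s))"
  using assms
proof (induction s)
  case (Suc s)
  show ?case
  proof (cases "s = r")
    case True
    have "braid_eq (Suc m)
      ([(Suc r, True), (r, True), (r, True)] @ (Suc r, False) # (Suc r, \<not> False) # [(Suc r, True)])
      ([(Suc r, True), (r, True), (r, True)] @ [(Suc r, True)])"
      using True Suc.prems by (intro cancel_context) (auto simp: words_simps)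
    then show ?thesis using True
      by (simp add: pure_gen_base pure_gen_step pres_eq.sym)
  next
    case False
    then have s: "r < s" "Suc s \<in> {1..<Suc m}" using Suc.prems by auto
    let ?A = "pure_gen r (Suc s)" and ?B = "pure_gen (Suc r) (Suc s)"
    have w: "?A \<in> words {1..<Suc m}" "?B \<in> words {1..<Suc m}"
      using Suc.prems s by (auto simp del: One_nat_def intro!: pure_gen_words)
    have "braid_eq (Suc m) (double_strand r (pure_gen r s)) (?A @ ?B)"
      using Suc s by simp
    from pres_eq_context[OF this, of "[(Suc s, True)]" "[(Suc s, False)]"]
    have "braid_eq (Suc m) (double_strand r (pure_gen r (Suc s)))
        ((Suc s, True) # ?A @ ?B @ [(Suc s, False)])"
      using s by (simp add: pure_gen_step[of r s] double_strand_append track_pure_gen words_simps)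
    moreover have "braid_eq (Suc m)
        (((Suc s, True) # ?A) @ (Suc s, False) # (Suc s, \<not> False) # ?B @ [(Suc s, False)])
        (((Suc s, True) # ?A) @ ?B @ [(Suc s, False)])"
      using s w by (intro cancel_context) (auto simp: words_simps)
    ultimately show ?thesis
      using s by (auto simp: pure_gen_step[of _ "Suc s"] intro: pres_eq.trans pres_eq.sym)
  qed
qed simp

lemma braid3:
  assumes "1 \<le> i" "Suc i < m" 
  shows "braid_eq m [(i, True), (Suc i, True), (i, True)] [(Suc i, True), (i, True), (Suc i, True)]"
  using assms by (intro pres_eq.relation) (auto simp: braid_relations_def words_simps)

lemma braid3_inv:
  assumes "1 \<le> i" "Suc i < m"
  shows "braid_eq m [(i, False), (Suc i, False), (i, False)] [(Suc i, False), (i, False), (Suc i, False)]"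
    (is "braid_eq m ?u ?v")
proof -
  let ?l = "[(i, True), (Suc i, True), (i, True)]"
  let ?r = "[(Suc i, True), (i, True), (Suc i, True)]"
  have i: "i \<in> {1..<m}" "Suc i \<in> {1..<m}" using assms by auto
  note c = cancel_context[of _ "{1..<m}" _ _ "braid_relations m"]
  have uv: "?u \<in> words {1..<m}" "?v \<in> words {1..<m}" using i by (auto simp: words_simps)
  have "braid_eq m (?u @ ?l) []"
    using c[OF i(1), of "[(i,False),(Suc i,False)]" "[(Suc i,True),(i,True)]" False]
      c[OF i(2), of "[(i,False)]" "[(i,True)]" False]
      c[OF i(1), of "[]" "[]" False] i
    by (auto simp: words_simps intro: pres_eq.trans)
  then have 1: "braid_eq m ((?u @ ?l) @ ?v) ([] @ ?v)"
    by (intro pres_eq.append pres_eq.refl uv)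
  have "braid_eq m (?r @ ?v) []"
    using c[OF i(2), of "[(Suc i,True),(i,True)]" "[(i,False),(Suc i,False)]" True]
      c[OF i(1), of "[(Suc i,True)]" "[(Suc i,False)]" True]
      c[OF i(2), of "[]" "[]" True] i
    by (auto simp: words_simps intro: pres_eq.trans)
  then have 2: "braid_eq m (?u @ ?r @ ?v) (?u @ [])"
    by (intro pres_eq.append pres_eq.refl uv)
  have "braid_eq m (?u @ ?l @ ?v) (?u @ ?r @ ?v)"
    using braid3[OF assms] uv by (intro pres_eq_context) auto
  with 1 2 show ?thesis
    by simp (blast intro: pres_eq.trans pres_eq.sym)
qed

lemma letter_commute_inv:
  assumes "pres_eq X R ((x, True) # w) (w @ [(x, True)])" "x \<in> X" "w \<in> words X"
  shows "pres_eq X R ((x, False) # w) (w @ [(x, False)])"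
proof -
  have "pres_eq X R (((x, False) # w) @ (x, True) # (x, \<not> True) # []) (((x, False) # w) @ [])"
    using assms by (intro cancel_context) (auto simp: words_simps)
  moreover have "pres_eq X R ([(x, False)] @ ((x, True) # w) @ [(x, False)])
      ([(x, False)] @ (w @ [(x, True)]) @ [(x, False)])"
    using assms by (intro pres_eq_context) (auto simp: words_simps)
  moreover have "pres_eq X R ([] @ (x, False) # (x, \<not> False) # w @ [(x, False)])
      ([] @ w @ [(x, False)])"
    using assms by (intro cancel_context) (auto simp: words_simps)
  ultimately show ?thesis
    by simp (blast intro: pres_eq.trans pres_eq.sym)
qed

lemma letter_inv_commute:
  assumes "pres_eq X R [(x, True), (y, True)] [(y, True), (x, True)]" "x \<in> X" "y \<in> X"
  shows "pres_eq X R [(x, True), (y, False)] [(y, False), (x, True)]"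
  using letter_commute_inv[of X R y "[(x, True)]"] assms
  by (auto simp: words_simps intro: pres_eq.sym)

lemma far_commute:
  assumes "1 \<le> k" "k + 2 \<le> i" "i < m"
  shows "braid_eq m [(i, True), (k, b)] [(k, b), (i, True)]"
proof -
  have "braid_eq m [(k, True), (i, True)] [(i, True), (k, True)]"
    using assms by (intro pres_eq.relation) (auto simp: braid_relations_def words_simps)
  then have 1: "braid_eq m [(i, True), (k, True)] [(k, True), (i, True)]"
    by (rule pres_eq.sym)
  then show ?thesis
    using letter_inv_commute[OF 1] assms by (cases b) auto
qed

lemma far_commute_word:
  assumes "\<forall>(k, b)\<in>set w. 1 \<le> k \<and> k + 2 \<le> i" "i < m" "1 \<le> i"
  shows "braid_eq m ((i, True) # w) (w @ [(i, True)])"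
  using assms(1)
proof (induction w)
  case Nil
  then show ?case using assms by (auto intro!: pres_eq.refl simp: words_simps)
next
  case (Cons a w)
  obtain k b where a: "a = (k, b)" by force
  have w: "w \<in> words {1..<m}" using Cons.prems assms by (force simp: words_def)
  have "braid_eq m ([(i, True), (k, b)] @ w) ([(k, b), (i, True)] @ w)"
    using Cons.prems a assms w by (intro pres_eq.append pres_eq.refl far_commute) auto
  moreover have "braid_eq m ([(k, b)] @ ((i, True) # w)) ([(k, b)] @ (w @ [(i, True)]))"
    using Cons a assms by (intro pres_eq.append pres_eq.refl) (auto simp: words_simps)
  ultimately show ?case using a by (auto intro: pres_eq.trans)
qed

lemma far_commute_pure_gen:
  assumes "1 \<le> r" "r < s" "Suc s < m"
  shows "braid_eq m ((Suc s, b) # pure_gen r s) (pure_gen r s @ [(Suc s, b)])"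
proof -
  have "braid_eq m ((Suc s, True) # pure_gen r s) (pure_gen r s @ [(Suc s, True)])"
    using assms by (intro far_commute_word) (auto simp: pure_gen_def)
  moreover have "pure_gen r s \<in> words {1..<m}"
    using assms by (intro pure_gen_words) auto
  ultimately show ?thesis
    using letter_commute_inv[of "{1..<m}" "braid_relations m" "Suc s" "pure_gen r s"] assms
    by (cases b) auto
qed

lemma braid3_conj:
  assumes "1 \<le> i" "Suc i < m"
  shows "braid_eq m [(i, False), (Suc i, True), (i, True)] [(Suc i, True), (i, True), (Suc i, False)]"
proof -
  have i: "i \<in> {1..<m}" "Suc i \<in> {1..<m}" using assms by auto
  have "braid_eq m ([(i, False), (Suc i, True), (i, True)] @ (Suc i, True) # (Suc i, \<not> True) # [])
      ([(i, False), (Suc i, True), (i, True)] @ [])"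
    using i by (intro cancel_context) (auto simp: words_simps)
  moreover have "braid_eq m ([(i, False)] @ [(i, True), (Suc i, True), (i, True)] @ [(Suc i, False)])
      ([(i, False)] @ [(Suc i, True), (i, True), (Suc i, True)] @ [(Suc i, False)])"
    using i assms by (intro pres_eq_context braid3) (auto simp: words_simps)
  moreover have "braid_eq m ([] @ (i, False) # (i, \<not> False) # [(Suc i, True), (i, True), (Suc i, False)])
      ([] @ [(Suc i, True), (i, True), (Suc i, False)])"
    using i by (intro cancel_context) (auto simp: words_simps)
  ultimately show ?thesis
    by simp (blast intro: pres_eq.trans pres_eq.sym)
qed

lemma double_strand_pure_gen_right:
  assumes "1 \<le> r" "r < s" "s \<le> m"
  shows "braid_eq (Suc m) (double_strand s (pure_gen r s)) (pure_gen r s @ pure_gen r (Suc s))"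
  using assms
proof (induction s)
  case (Suc s)
  let ?E = "braid_eq (Suc m)"
  let ?X = "{1..<Suc m}"
  let ?s = "(s, True)" and ?s' = "(s, False)" and ?t = "(Suc s, True)" and ?t' = "(Suc s, False)"
  have X: "s \<in> ?X" "Suc s \<in> ?X" using Suc.prems by auto
  have st: "1 \<le> s" "Suc s < Suc m" using Suc.prems by auto
  show ?case
  proof (cases "s = r")
    case True
    have "?E ([?s, ?t, ?t, ?s] @ ?t # (Suc s, \<not> True) # []) ([?s, ?t, ?t, ?s] @ [])"
      using X by (intro cancel_context) (auto simp: words_simps)
    moreover have "?E ([?s, ?t] @ [?s, ?t, ?s] @ [?t']) ([?s, ?t] @ [?t, ?s, ?t] @ [?t'])"
      using X st by (intro pres_eq_context braid3) (auto simp: words_simps)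
    moreover have "?E ([?s] @ [?s, ?t, ?s] @ [?s, ?t']) ([?s] @ [?t, ?s, ?t] @ [?s, ?t'])"
      using X st by (intro pres_eq_context braid3) (auto simp: words_simps)
    ultimately have "?E [?s, ?t, ?t, ?s] [?s, ?s, ?t, ?s, ?s, ?t']"
      by simp (blast intro: pres_eq.trans pres_eq.sym)
    then show ?thesis using True by (simp add: pure_gen_base pure_gen_step)
  next
    case False
    then have s: "r < s" using Suc.prems by simp
    let ?A = "pure_gen r s"
    have A: "?A \<in> words ?X" using Suc.prems s by (intro pure_gen_words) auto
    have comm: "?E ((Suc s, b) # ?A) (?A @ [(Suc s, b)])" for b
      using Suc.prems s by (intro far_commute_pure_gen) auto
    have "?E ([?s, ?t] @ double_strand s ?A @ [?t', ?s']) ([?s, ?t] @ (?A @ pure_gen r (Suc s)) @ [?t', ?s'])"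
      using Suc s X by (intro pres_eq_context) (auto simp: words_simps)
    then have 1: "?E (double_strand (Suc s) (pure_gen r (Suc s))) ([?s, ?t] @ ?A @ [?s] @ ?A @ [?s', ?t', ?s'])"
      using s by (simp add: pure_gen_step double_strand_append track_pure_gen)
    have 2: "?E ([?s] @ (?t # ?A) @ ([?s] @ ?A @ [?s', ?t', ?s'])) ([?s] @ (?A @ [?t]) @ ([?s] @ ?A @ [?s', ?t', ?s']))"
      using X A by (intro pres_eq_context comm) (auto simp: words_simps)
    have 3: "?E ((?s # ?A @ [?t, ?s] @ ?A) @ [?s', ?t', ?s'] @ []) ((?s # ?A @ [?t, ?s] @ ?A) @ [?t', ?s', ?t'] @ [])"
      using X A st by (intro pres_eq_context braid3_inv) (auto simp: words_simps)
    have 4: "?E ((?s # ?A @ [?t, ?s]) @ (?t' # ?A) @ [?s', ?t']) ((?s # ?A @ [?t, ?s]) @ (?A @ [?t']) @ [?s', ?t'])"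
      using X A by (intro pres_eq_context comm) (auto simp: words_simps)
    have 5: "?E ((?s # ?A) @ [?s', ?t, ?s] @ (?A @ [?s', ?t'])) ((?s # ?A) @ [?t, ?s, ?t'] @ (?A @ [?s', ?t']))"
      using X A st by (intro pres_eq_context braid3_conj) (auto simp: words_simps)
    have "?E (double_strand (Suc s) (pure_gen r (Suc s))) (?s # ?A @ [?s', ?t, ?s] @ ?A @ [?s', ?t'])"
      using 1 2 3 4[THEN pres_eq.sym] 5[THEN pres_eq.sym] by simp (blast intro: pres_eq.trans)
    then show ?thesis using s by (simp add: pure_gen_step)
  qed
qed simp

lemma AP_face_formula:
  assumes "1 \<le> i" "i < j" "j \<le> Suc n" "t \<le> n"
  shows "braid_eq n (delete_strand (Suc t) (pure_gen i j))
    (if t + 1 < i then pure_gen (i - 1) (j - 1)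
     else if t + 1 = i then []
     else if t + 1 < j then pure_gen i (j - 1)
     else if t + 1 = j then []
     else pure_gen i j)"
proof (cases "t + 1 = i")
  case True
  then show ?thesis using delete_strand_pure_gen_same[of i j n] assms by simp
next
  case False
  then show ?thesis
    using assms by (auto simp: delete_strand_pure_gen_exact simp del: One_nat_def
        intro!: pres_eq.refl pure_gen_words words_Nil)
qed

lemma AP_degen_formula:
  assumes "1 \<le> i" "i < j" "j \<le> Suc n" "t \<le> n"
  shows "braid_eq (n + 2) (double_strand (Suc t) (pure_gen i j))
    (if t + 1 < i then pure_gen (i + 1) (j + 1)
     else if t + 1 = i then pure_gen i (j + 1) @ pure_gen (i + 1) (j + 1)
     else if t + 1 < j then pure_gen i (j + 1)
     else if t + 1 = j then pure_gen i j @ pure_gen i (j + 1)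
     else pure_gen i j)"
proof -
  consider "t + 1 = i" | "t + 1 = j" | "t + 1 \<noteq> i" "t + 1 \<noteq> j" by blast
  then show ?thesis
  proof cases
    case 1
    then show ?thesis using double_strand_pure_gen_left[of i j "Suc n"] assms by simp
  next
    case 2
    then show ?thesis using double_strand_pure_gen_right[of i j "Suc n"] assms by simp
  next
    case 3
    then show ?thesis
      using assms by (auto simp: double_strand_pure_gen_exact intro!: pres_eq.refl
          pure_gen_words[simplified])
  qed
qed

end

theory Submission
  imports Defs
begin

text \<open>
  A braid on \<open>n + 2\<close> strands that becomes trivial when its first strand is deleted is a loop that
  this strand describes in a disc punctured by the other \<open>n + 1\<close> strands. The group of these
  loops is free on the loops \<open>x\<^sub>j\<close> around the single punctures, hence also on the products
  \<open>\<xi> k = x\<^bsub>k+1\<^esub> \<cdots> x\<^bsub>n+1\<^esub>\<close> for \<open>k \<le> n\<close>, and \<open>\<xi> (n + 1) = 1\<close>. The isomorphism sends \<open>\<xi> k\<close> to the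
  simplex \<open>\<langle>0\<^sup>k, 1\<^bsup>n+1-k\<^esup>\<rangle>\<close>. Deleting the puncture \<open>j\<close> sets \<open>x\<^sub>j = 1\<close>, that is, it identifies
  \<open>\<xi> (j - 1)\<close> with \<open>\<xi> j\<close>; doubling it replaces \<open>x\<^sub>j\<close> by a product of two generators, that is, it
  inserts a new entry between \<open>\<xi> (j - 1)\<close> and \<open>\<xi> j\<close>. These are the faces and degeneracies of the
  simplices of \<open>\<Delta>[1]\<close>.

  The loop is read off a braid word by the function \<open>winding\<close>. Braids of the punctures act on the
  free group, and in terms of the \<open>\<xi> k\<close> a generator of the braid group changes one of them only.
  Instead of automorphisms of a free group one can therefore use assignments \<open>\<xi>\<close> of elements of an
  arbitrary group, transformed by the Hurwitz moves \<open>\<xi> i \<mapsto> \<xi> (i + 1) (\<xi> i)\<^sup>-\<^sup>1 \<xi> (i - 1)\<close>. The winding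
  of a word is then a group element that depends on the braid only (\<open>winding_braid_eq\<close>), is
  multiplicative on the kernel of \<open>d\<^sub>0\<close> (\<open>winding_append\<close>), natural in the group
  (\<open>winding_hom\<close>), and compatible with deleting and doubling strands
  (\<open>winding_delete_strand\<close>, \<open>winding_double_strand\<close>).

  With the simplices of \<open>\<Delta>[1]\<close> as assignment, the winding is a homomorphism to the free simplicial
  group. It is onto because each \<open>\<xi> k\<close> is the winding of an explicit word (\<open>circling_word\<close>). It is
  injective because the winding can also be computed in the braid group itself: there the elements
  \<open>loop_around k = A\<^bsub>1,k+2\<^esub> \<cdots> A\<^bsub>1,n+2\<^esub>\<close> are conjugated by the other strands according to the Hurwitz
  moves, so that every braid is the product of the winding of its first strand and of the braid of
  the others (\<open>braid_decomposition\<close>). A braid in the kernel of \<open>d\<^sub>0\<close> thus is its own winding, and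
  \<open>\<xi> k \<mapsto> loop_around k\<close> induces a left inverse. This proves both halves of the classical fact that
  the kernel is free on the \<open>A\<^bsub>1,j\<^esub>\<close>. Milnor's construction is a simplicial group for formal
  reasons, and the simplicial identities of the loop group are carried over from it.
\<close>


section \<open>Groups given by generators and relations\<close>

abbreviation pres_class :: "'a set \<Rightarrow> ('a word \<times> 'a word) set \<Rightarrow> 'a word \<Rightarrow> 'a word set" where
  "pres_class X R w \<equiv> pres_rel X R `` {w}"

lemma mem_pres_class [simp]: "(w, v) \<in> pres_rel X R \<longleftrightarrow> pres_eq X R w v"
  by (simp add: pres_rel_def)

lemma pres_class_self: "w \<in> words X \<Longrightarrow> w \<in> pres_class X R w"
  by (simp add: pres_eq.refl)

lemma pres_class_eqI: "pres_eq X R v w \<Longrightarrow> pres_class X R v = pres_class X R w"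
proof -
  assume "pres_eq X R v w"
  then have "pres_eq X R v u \<longleftrightarrow> pres_eq X R w u" for u
    using pres_eq.trans pres_eq.sym by metis
  then show ?thesis by auto
qed

lemma pres_class_eq_iff:
  "w \<in> words X \<Longrightarrow> pres_class X R v = pres_class X R w \<longleftrightarrow> pres_eq X R v w"
proof (intro iffI)
  assume w: "w \<in> words X" and eq: "pres_class X R v = pres_class X R w"
  have "w \<in> pres_class X R v"
    unfolding eq by (rule pres_class_self) (rule w)
  then show "pres_eq X R v w" by simp
qed (rule pres_class_eqI)

text \<open>This is how the face and degeneracy operators, which are unions over all
  representatives, are evaluated on a single representative.\<close>

lemma UN_pres_class:
  assumes "w \<in> words X" "\<And>v. pres_eq X R w v \<Longrightarrow> F v = F w"
  shows "(\<Union>v\<in>pres_class X R w. F v) = F w"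
proof (rule SUP_eq_const)
  show "pres_class X R w \<noteq> {}" using pres_class_self[OF assms(1)] by blast
  show "F v = F w" if "v \<in> pres_class X R w" for v
    using that by (intro assms(2)) simp
qed

lemma carrier_pres_group: "carrier (pres_group X R) = pres_class X R ` words X"
  by (auto simp: pres_group_def quotient_def)

lemma pres_class_closed: "w \<in> words X \<Longrightarrow> pres_class X R w \<in> carrier (pres_group X R)"
  by (simp add: carrier_pres_group)

lemma one_pres_group: "\<one>\<^bsub>pres_group X R\<^esub> = pres_class X R []"
  by (simp add: pres_group_def)

lemma pres_class_mult:
  assumes "v \<in> words X" "w \<in> words X"
  shows "pres_class X R v \<otimes>\<^bsub>pres_group X R\<^esub> pres_class X R w = pres_class X R (v @ w)"
proof -
  have "pres_class X R v \<otimes>\<^bsub>pres_group X R\<^esub> pres_class X R w =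
      (\<Union>v'\<in>pres_class X R v. \<Union>w'\<in>pres_class X R w. pres_class X R (v' @ w'))"
    by (simp add: pres_group_def)
  also have "\<dots> = (\<Union>v'\<in>pres_class X R v. pres_class X R (v' @ w))"
    by (intro SUP_cong refl UN_pres_class assms pres_class_eqI pres_eq.append)
      (auto dest: pres_eq_words intro: pres_eq.refl pres_eq.sym)
  also have "\<dots> = pres_class X R (v @ w)"
    by (intro UN_pres_class assms pres_class_eqI pres_eq.append)
      (auto intro: pres_eq.refl pres_eq.sym assms)
  finally show ?thesis .
qed

definition inv_word :: "'a word \<Rightarrow> 'a word" where
  "inv_word w = rev (map (\<lambda>(x, b). (x, \<not> b)) w)"

lemma inv_word_words: "w \<in> words X \<Longrightarrow> inv_word w \<in> words X"
  by (auto simp: inv_word_def words_def)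

lemma inv_word_cancel: "w \<in> words X \<Longrightarrow> pres_eq X R (inv_word w @ w) []"
proof (induction w)
  case Nil
  then show ?case by (simp add: inv_word_def pres_eq.refl words_simps)
next
  case (Cons a w)
  obtain x b where a: "a = (x, b)" by force
  have "pres_eq X R (inv_word w @ (x, \<not> b) # (x, \<not> \<not> b) # w) (inv_word w @ w)"
    using Cons.prems a by (intro cancel_context inv_word_words) (auto simp: words_simps)
  then show ?case using Cons a by (auto simp: inv_word_def words_simps intro: pres_eq.trans)
qed

lemma group_pres_group: "group (pres_group X R)"
proof (rule groupI)
  fix C assume "C \<in> carrier (pres_group X R)"
  then obtain w where "w \<in> words X" "C = pres_class X R w" by (auto simp: carrier_pres_group)
  then show "\<exists>D\<in>carrier (pres_group X R). D \<otimes>\<^bsub>pres_group X R\<^esub> C = \<one>\<^bsub>pres_group X R\<^esub>"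
    by (intro bexI[of _ "pres_class X R (inv_word w)"])
      (auto simp: pres_class_mult inv_word_words pres_class_closed one_pres_group
        pres_class_eqI[OF inv_word_cancel])
qed (auto simp: carrier_pres_group one_pres_group pres_class_mult words_simps)

primrec eval_letter :: "('g, 'm) monoid_scheme \<Rightarrow> ('a \<Rightarrow> 'g) \<Rightarrow> 'a \<Rightarrow> bool \<Rightarrow> 'g" where
  "eval_letter G f x True = f x"
| "eval_letter G f x False = inv\<^bsub>G\<^esub> f x"

fun eval_word :: "('g, 'm) monoid_scheme \<Rightarrow> ('a \<Rightarrow> 'g) \<Rightarrow> 'a word \<Rightarrow> 'g" where
  "eval_word G f [] = \<one>\<^bsub>G\<^esub>"
| "eval_word G f ((x, b) # w) = eval_letter G f x b \<otimes>\<^bsub>G\<^esub> eval_word G f w"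

context group
begin

lemma inv_cancel_left: "x \<in> carrier G \<Longrightarrow> y \<in> carrier G \<Longrightarrow> inv x \<otimes> (x \<otimes> y) = y"
  by (simp flip: m_assoc)

lemma cancel_inv_left: "x \<in> carrier G \<Longrightarrow> y \<in> carrier G \<Longrightarrow> x \<otimes> (inv x \<otimes> y) = y"
  by (simp flip: m_assoc)

text \<open>Together with the default rules for units and inverses, rewriting with these equations
  decides every identity that holds in free groups.\<close>

lemmas free_group_simps = m_assoc inv_mult_group inv_cancel_left cancel_inv_left

lemma eval_letter_closed: "f x \<in> carrier G \<Longrightarrow> eval_letter G f x b \<in> carrier G"
  by (cases b) auto

lemma eval_word_closed:
  "(\<And>x. x \<in> X \<Longrightarrow> f x \<in> carrier G) \<Longrightarrow> w \<in> words X \<Longrightarrow> eval_word G f w \<in> carrier G"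
  by (induction w) (auto simp: words_simps eval_letter_closed)

lemma eval_word_append:
  assumes "\<And>x. x \<in> X \<Longrightarrow> f x \<in> carrier G" "v \<in> words X" "w \<in> words X"
  shows "eval_word G f (v @ w) = eval_word G f v \<otimes> eval_word G f w"
  using assms(2)
  by (induction v)
    (use assms(1,3) eval_word_closed[of X f] in
      \<open>auto simp: words_simps eval_letter_closed m_assoc\<close>)

text \<open>The defining relations are the only thing to check, since equality of evaluations
  is a congruence that contains the free cancellations.\<close>

lemma eval_word_pres_eq:
  assumes "\<And>x. x \<in> X \<Longrightarrow> f x \<in> carrier G"
    and "\<And>l r. (l, r) \<in> R \<Longrightarrow> eval_word G f l = eval_word G f r"
    and "pres_eq X R v w"
  shows "eval_word G f v = eval_word G f w"
  using assms(3)
proof induction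
  case (append u u' v v')
  then show ?case using assms(1) by (simp add: eval_word_append[of X] pres_eq_words)
next
  case (cancel x b)
  then show ?case using assms(1) by (cases b) auto
qed (use assms in auto)

end

text \<open>The homomorphism of von Dyck's theorem. Any representative will do, because the relations are
  assumed to hold for \<open>f\<close> wherever the definition is used.\<close>

definition pres_lift :: "('g, 'm) monoid_scheme \<Rightarrow> ('a \<Rightarrow> 'g) \<Rightarrow> 'a word set \<Rightarrow> 'g" where
  "pres_lift G f C = eval_word G f (SOME w. w \<in> C)"

lemma pres_lift_class:
  assumes "group G" "\<And>x. x \<in> X \<Longrightarrow> f x \<in> carrier G"
    "\<And>l r. (l, r) \<in> R \<Longrightarrow> eval_word G f l = eval_word G f r" "w \<in> words X"
  shows "pres_lift G f (pres_class X R w) = eval_word G f w"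
proof -
  have "pres_eq X R w (SOME v. v \<in> pres_class X R w)"
    using someI[of "\<lambda>v. v \<in> pres_class X R w", OF pres_class_self[OF assms(4)]]
    by simp
  then show ?thesis
    unfolding pres_lift_def using group.eval_word_pres_eq[OF assms(1-3)] by metis
qed

lemma pres_lift_hom:
  assumes "group G" "\<And>x. x \<in> X \<Longrightarrow> f x \<in> carrier G"
    "\<And>l r. (l, r) \<in> R \<Longrightarrow> eval_word G f l = eval_word G f r"
  shows "pres_lift G f \<in> hom (pres_group X R) G"
  using assms(1) group.eval_word_closed[OF assms(1,2)] group.eval_word_append[OF assms(1,2)]
  by (auto simp: hom_def carrier_pres_group pres_class_mult pres_lift_class[OF assms] words_simps)

lemma pres_class_inverse_letter:
  assumes "x \<in> X"
  shows "inv\<^bsub>pres_group X R\<^esub> pres_class X R [(x, True)] = pres_class X R [(x, False)]"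
proof -
  interpret group "pres_group X R" by (rule group_pres_group)
  have "pres_class X R [(x, False)] \<otimes>\<^bsub>pres_group X R\<^esub> pres_class X R [(x, True)]
      = \<one>\<^bsub>pres_group X R\<^esub>"
    using assms pres_eq.cancel[of x X R False]
    by (auto simp: pres_class_mult words_simps one_pres_group pres_class_eq_iff)
  then show ?thesis
    using assms by (intro inv_equality) (auto simp: words_simps pres_class_closed)
qed

lemma eval_word_generators:
  assumes "\<And>x. x \<in> X \<Longrightarrow> f x = pres_class X R [(x, True)]" "w \<in> words X"
  shows "eval_word (pres_group X R) f w = pres_class X R w"
  using assms(2)
proof (induction w)
  case (Cons a w)
  obtain x b where a: "a = (x, b)" by force
  then have x: "x \<in> X" "w \<in> words X" using Cons.prems by (auto simp: words_simps)
  then have "eval_letter (pres_group X R) f x b = pres_class X R [(x, b)]"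
    by (cases b) (simp_all add: assms(1) pres_class_inverse_letter)
  then show ?case
    using Cons.IH x a pres_class_mult[of "[(x, b)]" X w R] by (simp add: words_simps)
qed (simp add: one_pres_group)

text \<open>This gives surjectivity onto a presented group from a few preimages.\<close>

lemma pres_group_generated:
  assumes "subgroup H (pres_group X R)" "\<And>x. x \<in> X \<Longrightarrow> pres_class X R [(x, True)] \<in> H"
  shows "H = carrier (pres_group X R)"
proof -
  interpret group "pres_group X R" by (rule group_pres_group)
  have "pres_class X R w \<in> H" if "w \<in> words X" for w
    using that
  proof (induction w)
    case Nil
    then show ?case using subgroup.one_closed[OF assms(1)] by (simp add: one_pres_group)
  next
    case (Cons a w)
    obtain x b where a: "a = (x, b)" by force
    then have x: "x \<in> X" "w \<in> words X" using Cons.prems by (auto simp: words_simps)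
    have "pres_class X R [(x, b)] \<in> H"
      using assms(2)[OF x(1)] subgroup.m_inv_closed[OF assms(1)]
        pres_class_inverse_letter[OF x(1), of R, symmetric] by (cases b) auto
    then have "pres_class X R [(x, b)] \<otimes>\<^bsub>pres_group X R\<^esub> pres_class X R w \<in> H"
      using subgroup.m_closed[OF assms(1)] Cons x by blast
    then show ?case using x a by (simp add: pres_class_mult words_simps)
  qed
  then show ?thesis using subgroup.subset[OF assms(1)] by (auto simp: carrier_pres_group)
qed


section \<open>Deleting and doubling a strand respect the braid relations\<close>

lemma track_range: "w \<in> words {1..<m} \<Longrightarrow> p \<in> {1..m} \<Longrightarrow> track p w \<in> {1..m}"
  by (induction p w rule: track.induct) (auto simp: words_simps)

lemma delete_strand_words:
  "w \<in> words {1..<m} \<Longrightarrow> p \<in> {1..m} \<Longrightarrow> delete_strand p w \<in> words {1..<m - 1}"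
  by (induction p w rule: delete_strand.induct) (auto simp: words_simps)

lemma double_strand_words:
  "w \<in> words {1..<m} \<Longrightarrow> double_strand p w \<in> words {1..<Suc m}"
  by (induction p w rule: double_strand.induct) (auto simp: words_simps)

text \<open>Rule induction with the two braid relations as separate cases; it shows that the
  course of a strand, the braid without a strand or with a doubled strand, the Hurwitz
  moves and the winding depend only on the braid.\<close>

lemma braid_eq_induct [consumes 1, case_names refl sym trans append cancel far near]:
  assumes "braid_eq m v w"
    and "\<And>w. w \<in> words {1..<m} \<Longrightarrow> P w w"
    and "\<And>v w. braid_eq m v w \<Longrightarrow> P v w \<Longrightarrow> P w v"
    and "\<And>u v w. braid_eq m u v \<Longrightarrow> braid_eq m v w \<Longrightarrow> P u v \<Longrightarrow> P v w \<Longrightarrow> P u w"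
    and "\<And>u u' v v'. braid_eq m u u' \<Longrightarrow> braid_eq m v v' \<Longrightarrow> P u u' \<Longrightarrow> P v v' \<Longrightarrow> P (u @ v) (u' @ v')"
    and "\<And>i b. 1 \<le> i \<Longrightarrow> i < m \<Longrightarrow> P [(i, b), (i, \<not> b)] []"
    and "\<And>i j. 1 \<le> i \<Longrightarrow> i + 2 \<le> j \<Longrightarrow> j < m \<Longrightarrow>
      P [(i, True), (j, True)] [(j, True), (i, True)]"
    and "\<And>i. 1 \<le> i \<Longrightarrow> Suc i < m \<Longrightarrow>
      P [(i, True), (Suc i, True), (i, True)] [(Suc i, True), (i, True), (Suc i, True)]"
  shows "P v w"
  using assms(1)
proof induction
  case (relation l r)
  then show ?case using assms(7,8) by (auto simp: braid_relations_def)
qed (use assms in auto)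

lemma track_braid_eq: "braid_eq m v w \<Longrightarrow> track p v = track p w"
  by (induction arbitrary: p rule: braid_eq_induct) (auto simp: track_append)

lemma far_relation:
  assumes "1 \<le> i" "i + 2 \<le> j" "j < m"
  shows "braid_eq m [(i, True), (j, True)] [(j, True), (i, True)]"
  using far_commute[OF assms(1,2,3), of True] by (rule pres_eq.sym)

text \<open>In each braid relation, deleting a strand that takes part in one of its crossings
  leaves the same word on both sides, and deleting any other strand leaves a relation of
  the same kind.\<close>

lemma delete_strand_braid_eq:
  assumes "braid_eq m v w" "p \<in> {1..m}"
  shows "braid_eq (m - 1) (delete_strand p v) (delete_strand p w)"
  using assms
proof (induction arbitrary: p rule: braid_eq_induct)
  case (refl w)
  then show ?case by (intro pres_eq.refl delete_strand_words)
next
  case (sym v w)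
  then show ?case by (blast intro: pres_eq.sym)
next
  case (trans u v w)
  then show ?case by (blast intro: pres_eq.trans)
next
  case (append u u' v v')
  then have "track p u \<in> {1..m}" using track_range pres_eq_words by blast
  with append show ?case
    using track_braid_eq[OF append.hyps(1), of p]
    by (auto simp: delete_strand_append simp del: One_nat_def intro!: pres_eq.append)
next
  case (cancel i b)
  then show ?case
    by (auto intro!: pres_eq.refl pres_eq.cancel simp: words_simps)
next
  case (far i j)
  then show ?case
    by (auto intro!: pres_eq.refl far_relation simp: words_simps simp del: One_nat_def)
next
  case (near i)
  then show ?case
    using braid3[of "i - 1" "m - 1"] braid3[of i "m - 1"]
    by (auto intro!: pres_eq.refl simp: words_simps)
qed

lemma far_pair_commute:
  assumes "1 \<le> i" "i + 2 \<le> j" "j < m" "1 \<le> i'" "i' + 2 \<le> j"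
  shows "braid_eq m [(i, True), (i', True), (j, True)] [(j, True), (i, True), (i', True)]"
proof -
  have "braid_eq m ((j, True) # [(i, True), (i', True)]) ([(i, True), (i', True)] @ [(j, True)])"
    using assms by (intro far_commute_word) auto
  then show ?thesis by (auto intro: pres_eq.sym)
qed

lemma pair_far_commute:
  assumes "1 \<le> i" "i + 2 \<le> j" "j < m" "i + 2 \<le> j'" "j' < m"
  shows "braid_eq m [(i, True), (j, True), (j', True)] [(j, True), (j', True), (i, True)]"
proof -
  have i: "i \<in> {1..<m}" "j \<in> {1..<m}" "j' \<in> {1..<m}" using assms by auto
  have "braid_eq m ([] @ [(i, True), (j, True)] @ [(j', True)]) ([] @ [(j, True), (i, True)] @ [(j', True)])"
    using assms i by (intro pres_eq_context far_relation) (auto simp: words_simps)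
  moreover have "braid_eq m ([(j, True)] @ [(i, True), (j', True)] @ []) ([(j, True)] @ [(j', True), (i, True)] @ [])"
    using assms i by (intro pres_eq_context far_relation) (auto simp: words_simps)
  ultimately show ?thesis by (auto intro: pres_eq.trans)
qed

text \<open>The braid relation for a ribbon of two parallel strands and two single strands, in the
  three possible positions of the ribbon.\<close>

lemma ribbon_braid:
  assumes "1 \<le> i" "Suc (Suc i) < m"
  shows "braid_eq m
      [(Suc i, True), (i, True), (Suc (Suc i), True), (Suc i, True), (i, True)]
      [(Suc (Suc i), True), (Suc i, True), (i, True), (Suc (Suc i), True), (Suc i, True)]"
    and "braid_eq m
      [(i, True), (Suc i, True), (Suc (Suc i), True), (i, True), (Suc i, True)]
      [(Suc i, True), (Suc (Suc i), True), (i, True), (Suc i, True), (Suc (Suc i), True)]"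
    and "braid_eq m
      [(i, True), (Suc i, True), (Suc (Suc i), True), (Suc i, True), (i, True)]
      [(Suc (Suc i), True), (Suc i, True), (i, True), (Suc i, True), (Suc (Suc i), True)]"
proof -
  let ?a = "(i, True)" and ?b = "(Suc i, True)" and ?c = "(Suc (Suc i), True)"
  have w: "v \<in> words {1..<m}" if "set v \<subseteq> {?a, ?b, ?c}" for v
    using that assms by (force simp: words_def)
  have ab: "braid_eq m (u @ [?a, ?b, ?a] @ v) (u @ [?b, ?a, ?b] @ v)"
    and bc: "braid_eq m (u @ [?b, ?c, ?b] @ v) (u @ [?c, ?b, ?c] @ v)"
    and ac: "braid_eq m (u @ [?a, ?c] @ v) (u @ [?c, ?a] @ v)"
    if "set u \<subseteq> {?a, ?b, ?c}" "set v \<subseteq> {?a, ?b, ?c}" for u v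
    by (intro pres_eq_context w that braid3 far_relation; use assms in simp)+
  note S = pres_eq.sym and T = pres_eq.trans
  show "braid_eq m [?b, ?a, ?c, ?b, ?a] [?c, ?b, ?a, ?c, ?b]"
    using ac[of "[?b]" "[?b, ?a]"] ab[of "[?b, ?c]" "[]"] bc[of "[]" "[?a, ?b]"]
      S[OF ac[of "[?c, ?b]" "[?b]"]]
    by simp (blast intro: T S)
  show "braid_eq m [?a, ?b, ?c, ?a, ?b] [?b, ?c, ?a, ?b, ?c]"
    using S[OF ac[of "[?a, ?b]" "[?b]"]] ab[of "[]" "[?c, ?b]"] bc[of "[?b, ?a]" "[]"]
      ac[of "[?b]" "[?b, ?c]"]
    by simp (blast intro: T S)
  show "braid_eq m [?a, ?b, ?c, ?b, ?a] [?c, ?b, ?a, ?b, ?c]"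
    using bc[of "[?a]" "[?a]"] ac[of "[]" "[?b, ?c, ?a]"] S[OF ac[of "[?c, ?a, ?b]" "[]"]]
      ab[of "[?c]" "[?c]"]
    by simp (blast intro: T S)
qed

text \<open>When the doubled strand is one of those that cross, a far commutation becomes a
  commutation of one letter with two, and a braid relation becomes one of the ribbon
  relations.\<close>

lemma double_strand_braid_eq:
  assumes "braid_eq m v w"
  shows "braid_eq (Suc m) (double_strand p v) (double_strand p w)"
  using assms
proof (induction arbitrary: p rule: braid_eq_induct)
  case (refl w)
  then show ?case by (intro pres_eq.refl double_strand_words)
next
  case (sym v w)
  then show ?case by (blast intro: pres_eq.sym)
next
  case (trans u v w)
  then show ?case by (blast intro: pres_eq.trans)
next
  case (append u u' v v')
  then show ?case
    using track_braid_eq[OF append.hyps(1), of p]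
    by (auto simp: double_strand_append intro!: pres_eq.append)
next
  case (cancel i b)
  then have i: "i \<in> {1..<Suc m}" "Suc i \<in> {1..<Suc m}" by auto
  note c = cancel_context[where R = "braid_relations (Suc m)" and c = b]
    and c' = pres_eq.cancel[where R = "braid_relations (Suc m)" and b = b]
  have "braid_eq (Suc m) [(i, b), (Suc i, b), (Suc i, \<not> b), (i, \<not> b)] []"
    using pres_eq.trans[OF c[OF i(2), of "[(i, b)]" "[(i, \<not> b)]"]] c'[OF i(1)] i
    by (simp add: words_simps)
  moreover have "braid_eq (Suc m) [(Suc i, b), (i, b), (i, \<not> b), (Suc i, \<not> b)] []"
    using pres_eq.trans[OF c[OF i(1), of "[(Suc i, b)]" "[(Suc i, \<not> b)]"]] c'[OF i(2)] i
    by (simp add: words_simps)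
  ultimately show ?case using c'[OF i(1)] c'[OF i(2)] by simp
next
  case (far i j)
  then show ?case
    by (auto intro!: pres_eq.refl far_relation far_pair_commute pair_far_commute simp: words_simps simp del: One_nat_def)
next
  case (near i)
  then show ?case
    using braid3[of "Suc i" "Suc m"] braid3[of i "Suc m"] ribbon_braid[of i "Suc m"]
    by (auto intro!: pres_eq.refl simp: words_simps)
qed

definition after_delete :: "nat \<Rightarrow> nat \<Rightarrow> nat" where
  "after_delete q p = (if q < p then p - 1 else p)"

definition after_double :: "nat \<Rightarrow> nat \<Rightarrow> nat" where
  "after_double q p = (if q < p then Suc p else p)"

lemma after_delete_simps:
  "q < p \<Longrightarrow> after_delete q p = p - 1" "p \<le> q \<Longrightarrow> after_delete q p = p"
  by (simp_all add: after_delete_def)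

lemma after_double_simps:
  "q < p \<Longrightarrow> after_double q p = Suc p" "p \<le> q \<Longrightarrow> after_double q p = p"
  by (simp_all add: after_double_def)

text \<open>A strand other than the deleted one keeps its course; only the count of the
  positions before it changes. The same holds for a doubled strand.\<close>

lemma track_delete_strand:
  "p \<noteq> q \<Longrightarrow> track (after_delete q p) (delete_strand q w) = after_delete (track q w) (track p w)"
proof (induction w arbitrary: p q)
  case (Cons a w)
  obtain i b where a: "a = (i, b)" by force
  have "p < i \<or> p = i \<or> p = Suc i \<or> Suc i < p" "q < i \<or> q = i \<or> q = Suc i \<or> Suc i < q"
    "p < q \<or> q < p" using Cons.prems by linarith+
  then show ?case
    using Cons.prems Cons.IH[of "track p [a]" "track q [a]"] a
    by (elim disjE; simp add: after_delete_simps; auto)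
qed simp

lemma delete_strand_commute:
  "p < q \<Longrightarrow> delete_strand p (delete_strand q w) = delete_strand (q - 1) (delete_strand p w)"
proof (induction w arbitrary: p q)
  case (Cons a w)
  obtain i b where a: "a = (i, b)" by force
  consider "Suc i < p" | "Suc i = p" | "i = p" "Suc i < q" | "i = p" "q = Suc i"
    | "p < i" "Suc i < q" | "p < i" "Suc i = q" | "p < i" "i = q" | "q < i" "p < i - 1"
    using Cons.prems by linarith
  then show ?case
  proof cases
    case 4
    \<comment> \<open>The two strands cross each other, which exchanges their roles.\<close>
    then show ?thesis using a Cons.IH[of i "Suc i"] by simp
  qed (use Cons.prems Cons.IH[of "track p [a]" "track q [a]"] a in auto)
qed simp

lemma delete_strand_after_delete:
  "p \<noteq> q \<Longrightarrow> delete_strand (after_delete q p) (delete_strand q w) =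
    delete_strand (after_delete p q) (delete_strand p w)"
  using delete_strand_commute[of p q w] delete_strand_commute[of q p w]
  by (cases p q rule: linorder_cases) (simp_all add: after_delete_simps)

lemma track_double_strand:
  "p \<noteq> q \<Longrightarrow> track (after_double q p) (double_strand q w) = after_double (track q w) (track p w)"
proof (induction w arbitrary: p q)
  case (Cons a w)
  obtain i b where a: "a = (i, b)" by force
  have "p < i \<or> p = i \<or> p = Suc i \<or> Suc i < p" "q < i \<or> q = i \<or> q = Suc i \<or> Suc i < q"
    "p < q \<or> q < p" using Cons.prems by linarith+
  then show ?case
    using Cons.prems Cons.IH[of "track p [a]" "track q [a]"] a
    by (elim disjE; simp add: after_double_simps; auto)
qed simp

lemma delete_double_strand_commute:
  "p \<noteq> q \<Longrightarrow> delete_strand (after_double q p) (double_strand q w) =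
    double_strand (after_delete p q) (delete_strand p w)"
proof (induction w arbitrary: p q)
  case (Cons a w)
  obtain i b where a: "a = (i, b)" by force
  have "p < i \<or> p = i \<or> p = Suc i \<or> Suc i < p" "q < i \<or> q = i \<or> q = Suc i \<or> Suc i < q"
    "p < q \<or> q < p" using Cons.prems by linarith+
  then show ?case
    using Cons.prems Cons.IH[of "track p [a]" "track q [a]"] a
    by (elim disjE; simp add: after_double_simps after_delete_simps; auto)
qed simp

lemma word_perm_track: "word_perm w (track p w) = p"
  by (induction p w rule: track.induct) (auto simp: transpose_def)

lemma track_eq_iff: "track p w = track q w \<longleftrightarrow> p = q"
  by (metis word_perm_track)

lemma word_perm_eq_iff: "word_perm w x = word_perm w y \<longleftrightarrow> x = y"
  by (induction w rule: word_perm.induct) (auto dest: transpose_eq_imp_eq)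

lemma word_perm_eq_id_iff: "word_perm w = id \<longleftrightarrow> (\<forall>p. track p w = p)"
  using word_perm_track[of w] word_perm_eq_iff[of w] by (metis eq_id_iff)


section \<open>The Hurwitz action and the winding cocycle\<close>

text \<open>In a disc with punctures \<open>1, \<dots>, N\<close>, let \<open>x\<^sub>j\<close> be the loop around the puncture \<open>j\<close>
  and \<open>\<xi> k = x\<^bsub>k+1\<^esub> \<dots> x\<^sub>N\<close>. The crossing of the punctures \<open>i\<close> and \<open>i + 1\<close> sends \<open>x\<^sub>i\<close> to
  \<open>x\<^bsub>i+1\<^esub>\<close> and \<open>x\<^bsub>i+1\<^esub>\<close> to \<open>x\<^bsub>i+1\<^esub>\<^sup>-\<^sup>1 x\<^sub>i x\<^bsub>i+1\<^esub>\<close>. In terms of the products \<open>\<xi>\<close> this changes only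
  the single value \<open>\<xi> i\<close>, and the formula makes sense for every assignment \<open>\<xi>\<close> of group
  elements.\<close>

definition hurwitz :: "('g, 'm) monoid_scheme \<Rightarrow> nat \<Rightarrow> bool \<Rightarrow> (nat \<Rightarrow> 'g) \<Rightarrow> nat \<Rightarrow> 'g" where
  "hurwitz G i b \<xi> = \<xi>(i :=
     if b then \<xi> (i + 1) \<otimes>\<^bsub>G\<^esub> inv\<^bsub>G\<^esub> \<xi> i \<otimes>\<^bsub>G\<^esub> \<xi> (i - 1)
     else \<xi> (i - 1) \<otimes>\<^bsub>G\<^esub> inv\<^bsub>G\<^esub> \<xi> i \<otimes>\<^bsub>G\<^esub> \<xi> (i + 1))"

fun hurwitz_word :: "('g, 'm) monoid_scheme \<Rightarrow> nat word \<Rightarrow> (nat \<Rightarrow> 'g) \<Rightarrow> nat \<Rightarrow> 'g" where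
  "hurwitz_word G [] \<xi> = \<xi>"
| "hurwitz_word G ((i, b) # w) \<xi> = hurwitz_word G w (hurwitz G i b \<xi>)"

text \<open>The loop that the strand in position \<open>p\<close> describes among the other strands.
  Passing the strand \<open>i\<close> of the others on one side, it picks up the generator \<open>x\<^sub>i = \<xi> (i
  - 1) (\<xi> i)\<^sup>-\<^sup>1\<close> on the way to the right and its inverse on the way back; passing on the
  other side contributes nothing. A crossing of two other strands acts on the assignment
  by a Hurwitz move, whose index is that of the left one of these strands among the
  strands other than \<open>p\<close>.\<close>

fun winding :: "('g, 'm) monoid_scheme \<Rightarrow> (nat \<Rightarrow> 'g) \<Rightarrow> nat \<Rightarrow> nat word \<Rightarrow> 'g" where
  "winding G \<xi> p [] = \<one>\<^bsub>G\<^esub>"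
| "winding G \<xi> p ((i, b) # w) =
     (if p < i then winding G (hurwitz G (i - 1) b \<xi>) p w
      else if p = i then
        (if b then \<xi> (i - 1) \<otimes>\<^bsub>G\<^esub> inv\<^bsub>G\<^esub> \<xi> i else \<one>\<^bsub>G\<^esub>) \<otimes>\<^bsub>G\<^esub> winding G \<xi> (Suc i) w
      else if p = Suc i then
        (if b then \<one>\<^bsub>G\<^esub> else \<xi> i \<otimes>\<^bsub>G\<^esub> inv\<^bsub>G\<^esub> \<xi> (i - 1)) \<otimes>\<^bsub>G\<^esub> winding G \<xi> i w
      else winding G (hurwitz G i b \<xi>) p w)"

context group
begin

lemma hurwitz_closed: "(\<And>k. \<xi> k \<in> carrier G) \<Longrightarrow> hurwitz G i b \<xi> k \<in> carrier G"
  by (auto simp: hurwitz_def)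

lemma hurwitz_other: "k \<noteq> i \<Longrightarrow> hurwitz G i b \<xi> k = \<xi> k"
  by (simp add: hurwitz_def)

lemma hurwitz_word_closed: "(\<And>k. \<xi> k \<in> carrier G) \<Longrightarrow> hurwitz_word G w \<xi> k \<in> carrier G"
  by (induction w arbitrary: \<xi>) (auto simp: hurwitz_closed)

lemma winding_closed: "(\<And>k. \<xi> k \<in> carrier G) \<Longrightarrow> winding G \<xi> p w \<in> carrier G"
  by (induction w arbitrary: \<xi> p) (auto simp: hurwitz_closed)

lemma hurwitz_inverse:
  "(\<And>k. \<xi> k \<in> carrier G) \<Longrightarrow> 1 \<le> i \<Longrightarrow> hurwitz G i (\<not> b) (hurwitz G i b \<xi>) = \<xi>"
  by (cases b) (auto simp: hurwitz_def free_group_simps)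

text \<open>Moves whose indices differ by at least two do not read each other's new value.\<close>

lemma hurwitz_far:
  assumes "\<And>k. \<xi> k \<in> carrier G" "1 \<le> i" "i + 2 \<le> j"
  shows "hurwitz G i b (hurwitz G j c \<xi>) = hurwitz G j c (hurwitz G i b \<xi>)"
  using assms by (auto simp: hurwitz_def fun_eq_iff)

lemma hurwitz_near:
  assumes "\<And>k. \<xi> k \<in> carrier G" "1 \<le> i"
  shows "hurwitz G i True (hurwitz G (Suc i) True (hurwitz G i True \<xi>)) =
    hurwitz G (Suc i) True (hurwitz G i True (hurwitz G (Suc i) True \<xi>))"
  using assms by (auto simp: hurwitz_def fun_eq_iff free_group_simps)

lemma hurwitz_word_append: "hurwitz_word G (u @ v) \<xi> = hurwitz_word G v (hurwitz_word G u \<xi>)"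
  by (induction u arbitrary: \<xi>) auto

lemma hurwitz_word_braid_eq:
  assumes "braid_eq m v w" "\<And>k. \<xi> k \<in> carrier G"
  shows "hurwitz_word G v \<xi> = hurwitz_word G w \<xi>"
  using assms
proof (induction arbitrary: \<xi> rule: braid_eq_induct)
  case (trans u v w)
  then show ?case by metis
next
  case (append u u' v v')
  then show ?case by (simp add: hurwitz_word_append hurwitz_word_closed)
next
  case (cancel i b)
  then show ?case using hurwitz_inverse[of \<xi> i b] by simp
next
  case (far i j)
  then show ?case using hurwitz_far[of \<xi> i j True True] by simp
next
  case (near i)
  then show ?case using hurwitz_near[of \<xi> i] by simp
qed auto

text \<open>The winding is a crossed homomorphism: what follows \<open>u\<close> is read with the
  assignment that the other strands of \<open>u\<close> have moved. It is multiplicative where these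
  other strands form a trivial braid.\<close>

lemma winding_append:
  "(\<And>k. \<xi> k \<in> carrier G) \<Longrightarrow> winding G \<xi> p (u @ v) =
    winding G \<xi> p u \<otimes> winding G (hurwitz_word G (delete_strand p u) \<xi>) (track p u) v"
  by (induction u arbitrary: \<xi> p)
    (auto simp: winding_closed hurwitz_closed hurwitz_word_closed m_assoc)

lemma winding_letter:
  assumes "\<And>k. \<xi> k \<in> carrier G"
  shows "winding G \<xi> p [(i, b)] =
    (if p = i \<and> b then \<xi> (i - 1) \<otimes> inv \<xi> i
     else if p = Suc i \<and> \<not> b then \<xi> i \<otimes> inv \<xi> (i - 1) else \<one>)"
  using assms by simp

text \<open>For every position of the strand, each braid relation becomes a Hurwitz relation
  if the strand is not involved, and an identity valid in free groups if it is.\<close>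

lemma winding_braid_eq:
  assumes "braid_eq m v w" "\<And>k. \<xi> k \<in> carrier G" "p \<in> {1..m}"
  shows "winding G \<xi> p v = winding G \<xi> p w"
  using assms
proof (induction arbitrary: \<xi> p rule: braid_eq_induct)
  case (trans u v w)
  then show ?case by metis
next
  case (append u u' v v')
  then have "track p u \<in> {1..m}"
    using track_range[of u m p] pres_eq_words[OF append.hyps(1)] by simp
  moreover have "hurwitz_word G (delete_strand p u) \<xi> = hurwitz_word G (delete_strand p u') \<xi>"
    using append.prems append.hyps(1) by (auto intro!: hurwitz_word_braid_eq[OF delete_strand_braid_eq])
  ultimately show ?case
    using append.IH(1)[OF append.prems] append.IH(2)[of "hurwitz_word G (delete_strand p u) \<xi>" "track p u"]
      append.prems(1) track_braid_eq[OF append.hyps(1), of p]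
    by (simp add: winding_append hurwitz_word_closed)
next
  case (cancel i b)
  then show ?case
    using hurwitz_inverse[of \<xi> i b] hurwitz_inverse[of \<xi> "i - 1" b]
    by (cases b) (auto simp: free_group_simps)
next
  case (far i j)
  then show ?case
    using hurwitz_far[of \<xi> i j True True] hurwitz_far[of \<xi> i "j - 1" True True]
      hurwitz_far[of \<xi> "i - 1" "j - 1" True True]
    by (auto simp: hurwitz_other)
next
  case (near i)
  then show ?case
    using hurwitz_near[of \<xi> i] hurwitz_near[of \<xi> "i - 1"]
    by (auto simp: free_group_simps hurwitz_def)
qed auto

end

lemma hurwitz_hom:
  assumes "group_hom G H h" "\<And>k. \<xi> k \<in> carrier G"
  shows "hurwitz H i b (\<lambda>k. h (\<xi> k)) = (\<lambda>k. h (hurwitz G i b \<xi> k))"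
proof -
  interpret group_hom G H h by fact
  show ?thesis using assms(2) by (auto simp: hurwitz_def fun_eq_iff)
qed

text \<open>Naturality in the group. It is used for conjugations of the braid group, for the
  operators of the free simplicial group, and for the homomorphism inverse to the
  winding.\<close>

lemma winding_hom:
  assumes "group_hom G H h" "\<And>k. \<xi> k \<in> carrier G"
  shows "h (winding G \<xi> p w) = winding H (\<lambda>k. h (\<xi> k)) p w"
  using assms(2)
proof (induction w arbitrary: \<xi> p)
  interpret group_hom G H h by fact
  case (Cons a w)
  then show ?case
    by (cases a)
      (auto simp: hurwitz_hom[OF assms(1)] G.hurwitz_closed G.winding_closed H.winding_closed)
qed (use assms(1) in \<open>simp add: group_hom.hom_one\<close>)

text \<open>Dropping the value \<open>\<xi> q\<close> merges the generators of the strands \<open>q\<close> and \<open>q + 1\<close> into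
  the generator of a ribbon, \<open>x\<^sub>q x\<^bsub>q+1\<^esub>\<close>. If \<open>\<xi> (q - 1) = \<xi> q\<close>, so that \<open>x\<^sub>q = 1\<close>, it
  forgets the strand \<open>q\<close>. Deleting and doubling a strand are thus the same operation on
  assignments.\<close>

definition omit :: "nat \<Rightarrow> (nat \<Rightarrow> 'a) \<Rightarrow> nat \<Rightarrow> 'a" where
  "omit q \<xi> k = (if k < q then \<xi> k else \<xi> (Suc k))"

lemma omit_fun_upd:
  "i < q \<Longrightarrow> omit q (\<xi>(i := x)) = (omit q \<xi>)(i := x)"
  "q < i \<Longrightarrow> omit q (\<xi>(i := x)) = (omit q \<xi>)(i - 1 := x)"
  "omit q (\<xi>(q := x)) = omit q \<xi>"
  by (auto simp: omit_def fun_eq_iff)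

lemma omit_repeated:
  assumes "\<xi> (q - 1) = \<xi> q" "1 \<le> q" "q < i"
  shows "omit q \<xi> (i - 1 - 1) = \<xi> (i - 1)"
  using assms by (cases "q = i - 1") (auto simp: omit_def intro!: arg_cong[of _ _ \<xi>])

lemma omit_Suc: "\<xi> q = \<xi> (Suc q) \<Longrightarrow> omit (Suc q) \<xi> = omit q \<xi>"
  by (auto simp: omit_def fun_eq_iff less_Suc_eq)

context group
begin

text \<open>A strand with trivial generator keeps a trivial generator along the whole braid,
  and its crossings have no effect on the other generators.\<close>

lemma hurwitz_word_delete_strand:
  assumes "\<And>k. \<xi> k \<in> carrier G" "1 \<le> q" "\<xi> (q - 1) = \<xi> q" "w \<in> words {1..<m}"
  shows "hurwitz_word G w \<xi> (track q w - 1) = hurwitz_word G w \<xi> (track q w) \<and>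
    hurwitz_word G (delete_strand q w) (omit q \<xi>) = omit (track q w) (hurwitz_word G w \<xi>)"
  using assms
proof (induction w arbitrary: \<xi> q)
  case (Cons a w)
  obtain i b where a: "a = (i, b)" by force
  then have i: "1 \<le> i" "w \<in> words {1..<m}" using Cons.prems by (auto simp: words_simps)
  let ?\<eta> = "hurwitz G i b \<xi>"
  have c: "?\<eta> k \<in> carrier G" for k using Cons.prems(1) by (rule hurwitz_closed)
  have eq: "?\<eta> (track q [a] - 1) = ?\<eta> (track q [a])"
    using Cons.prems i a by (auto simp: hurwitz_def free_group_simps)
  have om: "hurwitz_word G (delete_strand q [a]) (omit q \<xi>) = omit (track q [a]) ?\<eta>"
  proof -
    consider "q < i" | "q = i" | "q = Suc i" | "Suc i < q" by linarith
    then show ?thesis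
    proof cases
      case 1
      then have "omit q \<xi> (i - 1) = \<xi> i" "omit q \<xi> i = \<xi> (Suc i)"
        by (auto simp: omit_def)
      moreover have "omit q \<xi> (i - 1 - 1) = \<xi> (i - 1)"
        using 1 Cons.prems(2,3) by (intro omit_repeated)
      ultimately show ?thesis using 1 i by (simp add: a hurwitz_def omit_fun_upd)
    next
      case 2
      \<comment> \<open>After the crossing the values \<open>i\<close> and \<open>i + 1\<close> agree, so either may be dropped.\<close>
      then have "omit (Suc i) ?\<eta> = omit i ?\<eta>"
        using Cons.prems i by (intro omit_Suc) (auto simp: hurwitz_def free_group_simps)
      then show ?thesis using 2 by (simp add: a) (simp add: hurwitz_def omit_fun_upd)
    next
      case 3
      then have "omit (Suc i) \<xi> = omit i \<xi>"
        using Cons.prems by (intro omit_Suc) simp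
      then show ?thesis using 3 by (simp add: a) (simp add: hurwitz_def omit_fun_upd)
    next
      case 4
      then have "omit q \<xi> (i - 1) = \<xi> (i - 1)" "omit q \<xi> i = \<xi> i" "omit q \<xi> (Suc i) = \<xi> (Suc i)"
        by (auto simp: omit_def)
      then show ?thesis using 4 i by (simp add: a hurwitz_def omit_fun_upd)
    qed
  qed
  have t: "1 \<le> track q [a]" using Cons.prems i a by auto
  have "delete_strand q (a # w) = delete_strand q [a] @ delete_strand (track q [a]) w"
    using delete_strand_append[of q "[a]" w] by simp
  moreover have "track q (a # w) = track (track q [a]) w"
    using track_append[of q "[a]" w] by simp
  ultimately show ?case
    using Cons.IH[OF c t eq i(2)] om a by (simp add: hurwitz_word_append)
qed simp

text \<open>A ribbon of two strands moves like one strand whose generator is the product of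
  the two.\<close>

lemma hurwitz_word_double_strand:
  assumes "\<And>k. \<xi> k \<in> carrier G" "1 \<le> q" "w \<in> words {1..<m}"
  shows "hurwitz_word G w (omit q \<xi>) = omit (track q w) (hurwitz_word G (double_strand q w) \<xi>)"
  using assms
proof (induction w arbitrary: \<xi> q)
  case (Cons a w)
  obtain i b where a: "a = (i, b)" by force
  then have i: "1 \<le> i" "w \<in> words {1..<m}" using Cons.prems by (auto simp: words_simps)
  let ?\<eta> = "hurwitz_word G (double_strand q [a]) \<xi>"
  have c: "?\<eta> k \<in> carrier G" for k using Cons.prems(1) by (rule hurwitz_word_closed)
  have om: "hurwitz G i b (omit q \<xi>) = omit (track q [a]) ?\<eta>"
    using Cons.prems i a by (auto simp: hurwitz_def omit_def free_group_simps fun_eq_iff)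
  have t: "1 \<le> track q [a]" using Cons.prems i a by auto
  have "double_strand q (a # w) = double_strand q [a] @ double_strand (track q [a]) w"
    using double_strand_append[of q "[a]" w] by simp
  moreover have "track q (a # w) = track (track q [a]) w"
    using track_append[of q "[a]" w] by simp
  ultimately show ?case
    using Cons.IH[OF c t i(2)] om a by (simp add: hurwitz_word_append)
qed simp

lemma omit_closed: "(\<And>k. \<xi> k \<in> carrier G) \<Longrightarrow> omit q \<xi> k \<in> carrier G"
  by (simp add: omit_def)

text \<open>It suffices to compare the contribution of one letter. What follows agrees by the
  preceding description of the Hurwitz moves, applied to the strands other than \<open>p\<close>.\<close>

lemma winding_delete_strand:
  assumes "\<And>k. \<xi> k \<in> carrier G" "p \<noteq> q" "1 \<le> p" "1 \<le> q" "w \<in> words {1..<m}"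
    "\<xi> (after_delete p q - 1) = \<xi> (after_delete p q)"
  shows "winding G \<xi> p w = winding G (omit (after_delete p q) \<xi>) (after_delete q p) (delete_strand q w)"
  using assms
proof (induction w arbitrary: \<xi> p q)
  case (Cons a w)
  obtain i b where a: "a = (i, b)" by force
  then have i: "1 \<le> i" "w \<in> words {1..<m}" "[a] \<in> words {1..<Suc i}"
    using Cons.prems by (auto simp: words_simps)
  let ?q = "after_delete p q" and ?p = "after_delete q p"
  let ?p2 = "track p [a]" and ?q2 = "track q [a]" and ?\<eta> = "hurwitz_word G (delete_strand p [a]) \<xi>"
  have c: "?\<eta> k \<in> carrier G" for k using Cons.prems(1) by (rule hurwitz_word_closed)
  have q: "1 \<le> ?q" using Cons.prems by (auto simp: after_delete_def)
  have "delete_strand p [a] \<in> words {1..<Suc i}"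
    using i Cons.prems(3) a by (auto simp: words_simps)
  note H = hurwitz_word_delete_strand[OF Cons.prems(1) q Cons.prems(6) this,
      unfolded track_delete_strand[OF Cons.prems(2)[symmetric]]
        delete_strand_after_delete[OF Cons.prems(2), symmetric]]
  have IH: "winding G ?\<eta> ?p2 w =
      winding G (omit (after_delete ?p2 ?q2) ?\<eta>) (after_delete ?q2 ?p2) (delete_strand ?q2 w)"
    using H Cons.prems i a by (intro Cons.IH c) (auto simp: track_eq_iff)
  have split: "p < i \<or> p = i \<or> p = Suc i \<or> Suc i < p"
    "q < i \<or> q = i \<or> q = Suc i \<or> Suc i < q" "p < q \<or> q < p"
    using Cons.prems by linarith+
  \<comment> \<open>If the strands \<open>p\<close> and \<open>q\<close> cross, the contribution is \<open>\<one>\<close> because \<open>q\<close> has a trivial generator.\<close>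
  have letter: "winding G \<xi> p [a] = winding G (omit ?q \<xi>) ?p (delete_strand q [a])"
    using split Cons.prems(1,3,4,6) i omit_repeated[OF Cons.prems(6) q, of i]
    unfolding a winding_letter[OF Cons.prems(1)]
    by (elim disjE; simp add: winding_letter omit_closed after_delete_simps del: winding.simps(2);
      auto simp: omit_def)
  have "winding G \<xi> p ([a] @ w) = winding G \<xi> p [a] \<otimes> winding G ?\<eta> ?p2 w"
    using Cons.prems(1) by (rule winding_append)
  also have "\<dots> = winding G (omit ?q \<xi>) ?p (delete_strand q [a] @ delete_strand ?q2 w)"
    using H letter IH Cons.prems
    by (simp add: winding_append omit_closed track_delete_strand del: delete_strand.simps track.simps)
  finally show ?case using delete_strand_append[of q "[a]" w] by simp
qed simp

lemma winding_double_strand: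
  assumes "\<And>k. \<xi> k \<in> carrier G" "p \<noteq> q" "1 \<le> p" "1 \<le> q" "w \<in> words {1..<m}"
  shows "winding G (omit (after_delete p q) \<xi>) p w = winding G \<xi> (after_double q p) (double_strand q w)"
  using assms
proof (induction w arbitrary: \<xi> p q)
  case (Cons a w)
  obtain i b where a: "a = (i, b)" by force
  then have i: "1 \<le> i" "w \<in> words {1..<m}" "[a] \<in> words {1..<Suc i}"
    using Cons.prems by (auto simp: words_simps)
  let ?q = "after_delete p q" and ?p = "after_double q p"
  let ?p2 = "track p [a]" and ?q2 = "track q [a]"
    and ?\<eta> = "hurwitz_word G (double_strand (after_delete p q) (delete_strand p [a])) \<xi>"
  have c: "?\<eta> k \<in> carrier G" for k using Cons.prems(1) by (rule hurwitz_word_closed)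
  have q: "1 \<le> ?q" using Cons.prems by (auto simp: after_delete_def)
  have "delete_strand p [a] \<in> words {1..<Suc i}"
    using i Cons.prems(3) a by (auto simp: words_simps)
  note H = hurwitz_word_double_strand[OF Cons.prems(1) q this,
      unfolded track_delete_strand[OF Cons.prems(2)[symmetric]]]
  have IH: "winding G (omit (after_delete ?p2 ?q2) ?\<eta>) ?p2 w =
      winding G ?\<eta> (after_double ?q2 ?p2) (double_strand ?q2 w)"
    using Cons.prems i a by (intro Cons.IH c) (auto simp: track_eq_iff)
  have split: "p < i \<or> p = i \<or> p = Suc i \<or> Suc i < p"
    "q < i \<or> q = i \<or> q = Suc i \<or> Suc i < q" "p < q \<or> q < p"
    using Cons.prems by linarith+
  \<comment> \<open>If the strand \<open>p\<close> crosses the ribbon, the two contributions multiply to that of one strand.\<close>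
  have letter: "winding G (omit ?q \<xi>) p [a] = winding G \<xi> ?p (double_strand q [a])"
    using split Cons.prems(1,3,4) i unfolding a winding_letter[OF omit_closed[of \<xi>, OF Cons.prems(1)]]
    by (elim disjE; simp add: after_delete_simps after_double_simps;
      auto simp: omit_def free_group_simps)
  have "winding G (omit ?q \<xi>) p ([a] @ w) =
      winding G (omit ?q \<xi>) p [a] \<otimes> winding G (omit (after_delete ?p2 ?q2) ?\<eta>) ?p2 w"
    unfolding H[symmetric] using Cons.prems(1) by (intro winding_append omit_closed)
  also have "\<dots> = winding G \<xi> ?p (double_strand q [a] @ double_strand ?q2 w)"
    using letter IH Cons.prems
    by (simp add: winding_append omit_closed track_double_strand delete_double_strand_commute
        del: delete_strand.simps track.simps double_strand.simps)
  finally show ?case using double_strand_append[of q "[a]" w] by simp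
qed simp

end


section \<open>Pushing a strand to the front\<close>

primrec ascending :: "('g, 'm) monoid_scheme \<Rightarrow> (nat \<Rightarrow> 'g) \<Rightarrow> nat \<Rightarrow> 'g" where
  "ascending G t 0 = \<one>\<^bsub>G\<^esub>"
| "ascending G t (Suc k) = ascending G t k \<otimes>\<^bsub>G\<^esub> t (Suc k)"

text \<open>A family of elements that satisfies the braid relations, in any group. The closure
  of \<open>s\<close> is assumed for all indices, so that no side condition on the index is needed to
  multiply.\<close>

locale braid_elements = group G for G (structure) +
  fixes s :: "nat \<Rightarrow> 'a" and m :: nat
  assumes s_closed [simp]: "s i \<in> carrier G"
    and far: "1 \<le> i \<Longrightarrow> i + 2 \<le> j \<Longrightarrow> j < m \<Longrightarrow> s i \<otimes> s j = s j \<otimes> s i"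
    and near: "1 \<le> i \<Longrightarrow> Suc i < m \<Longrightarrow>
      s i \<otimes> s (Suc i) \<otimes> s i = s (Suc i) \<otimes> s i \<otimes> s (Suc i)"
begin

lemma ascending_closed [simp]: "ascending G s k \<in> carrier G"
  by (induction k) auto

lemma ascending_far: "k + 2 \<le> i \<Longrightarrow> i < m \<Longrightarrow> ascending G s k \<otimes> s i = s i \<otimes> ascending G s k"
proof (induction k)
  case (Suc k)
  have "ascending G s (Suc k) \<otimes> s i = ascending G s k \<otimes> (s (Suc k) \<otimes> s i)"
    by (simp add: m_assoc)
  also have "\<dots> = ascending G s k \<otimes> s i \<otimes> s (Suc k)"
    using far[of "Suc k" i] Suc.prems by (simp add: m_assoc)
  also have "\<dots> = s i \<otimes> ascending G s (Suc k)"
    using Suc by (simp add: m_assoc)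
  finally show ?case .
qed simp

lemma ascending_shift:
  "1 \<le> i \<Longrightarrow> i < k \<Longrightarrow> k < m \<Longrightarrow> ascending G s k \<otimes> s i = s (Suc i) \<otimes> ascending G s k"
proof (induction k)
  case (Suc k)
  show ?case
  proof (cases "i = k")
    case True
    then obtain j where k: "k = Suc j" using Suc.prems by (cases k) auto
    have "ascending G s (Suc k) \<otimes> s i = ascending G s j \<otimes> (s k \<otimes> s (Suc k) \<otimes> s k)"
      by (simp add: m_assoc k True)
    also have "\<dots> = ascending G s j \<otimes> s (Suc k) \<otimes> (s k \<otimes> s (Suc k))"
      using near[of k] Suc.prems True by (simp add: m_assoc)
    also have "\<dots> = s (Suc i) \<otimes> ascending G s (Suc k)"
      using ascending_far[of j "Suc k"] Suc.prems True by (simp add: m_assoc k)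
    finally show ?thesis .
  next
    case False
    have "ascending G s (Suc k) \<otimes> s i = ascending G s k \<otimes> s i \<otimes> s (Suc k)"
      using far[of i "Suc k"] Suc.prems False by (simp add: m_assoc)
    also have "\<dots> = s (Suc i) \<otimes> ascending G s (Suc k)"
      using Suc False by (simp add: m_assoc)
    finally show ?thesis .
  qed
qed simp

lemma inv_commute:
  assumes "x \<in> carrier G" "y \<in> carrier G" "z \<in> carrier G" "x \<otimes> y = z \<otimes> x"
  shows "x \<otimes> inv y = inv z \<otimes> x"
  using assms by (metis inv_closed inv_solve_left inv_solve_right m_assoc m_closed)

text \<open>The inverses satisfy the same relations, so that each fact on products \<open>s 1 \<cdots> s k\<close>
  also gives one on \<open>under k\<close>.\<close>

lemma braid_elements_inv: "braid_elements G (\<lambda>i. inv (s i)) m"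
proof
  show "inv s i \<otimes> inv s j = inv s j \<otimes> inv s i" if "1 \<le> i" "i + 2 \<le> j" "j < m" for i j
    using far[OF that] by (simp flip: inv_mult_group)
  show "inv s i \<otimes> inv s (Suc i) \<otimes> inv s i = inv s (Suc i) \<otimes> inv s i \<otimes> inv s (Suc i)"
    if "1 \<le> i" "Suc i < m" for i
    using near[OF that] by (simp add: m_assoc flip: inv_mult_group)
qed simp

text \<open>The first strand passes the next \<open>k\<close> strands on the side that contributes nothing
  to the winding. In \<open>under (p - 1) \<otimes> eval_word G s w\<close> the first strand continues as
  the strand in position \<open>p\<close> of \<open>w\<close>.\<close>

definition under :: "nat \<Rightarrow> 'a" where
  "under k = ascending G (\<lambda>i. inv (s i)) k"

lemma under_simps: "under 0 = \<one>" "under (Suc k) = under k \<otimes> inv s (Suc k)"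
  by (simp_all add: under_def)

lemma under_closed [simp]: "under k \<in> carrier G"
  unfolding under_def by (rule braid_elements.ascending_closed[OF braid_elements_inv])

lemma under_far: "k + 2 \<le> i \<Longrightarrow> i < m \<Longrightarrow> under k \<otimes> s i = s i \<otimes> under k"
  using braid_elements.ascending_far[OF braid_elements_inv, of k i] inv_commute[of "under k" "inv s i" "inv s i"]
  by (simp add: under_def[symmetric])

lemma under_shift:
  "1 \<le> i \<Longrightarrow> i < k \<Longrightarrow> k < m \<Longrightarrow> under k \<otimes> s i = s (Suc i) \<otimes> under k"
  using braid_elements.ascending_shift[OF braid_elements_inv, of i k]
    inv_commute[of "under k" "inv s i" "inv s (Suc i)"]
  by (simp add: under_def[symmetric])

text \<open>The inverse of the braid in which the first strand encircles the next \<open>k\<close> strands,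
  that is of \<open>A\<^bsub>1,2\<^esub> \<cdots> A\<^bsub>1,k+1\<^esub>\<close>.\<close>

definition sweep :: "nat \<Rightarrow> 'a" where
  "sweep k = under k \<otimes> inv (ascending G s k)"

lemma sweep_closed [simp]: "sweep k \<in> carrier G"
  by (simp add: sweep_def)

lemma commute_inv:
  assumes "x \<in> carrier G" "y \<in> carrier G" "z \<in> carrier G" "x \<otimes> y = z \<otimes> x"
  shows "y \<otimes> inv x = inv x \<otimes> z"
  using assms by (metis inv_closed inv_solve_left inv_solve_right m_assoc m_closed)

lemma sweep_commute:
  assumes "1 \<le> k" "Suc k < m" "j < m" "j \<noteq> k"
  shows "s (Suc k) \<otimes> sweep j = sweep j \<otimes> s (Suc k)"
proof -
  \<comment> \<open>Moving to the front past \<open>j\<close> strands shifts the crossing \<open>k\<close> of two of them by one, and leaves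
    a crossing of later strands as it is.\<close>
  define i where "i = (if j < k then Suc k else k)"
  have "under j \<otimes> s i = s (Suc k) \<otimes> under j" "ascending G s j \<otimes> s i = s (Suc k) \<otimes> ascending G s j"
    using under_far[of j "Suc k"] ascending_far[of j "Suc k"] under_shift[of k j] ascending_shift[of k j]
      assms by (auto simp: i_def)
  then show ?thesis
    using commute_inv[of "ascending G s j" "s i" "s (Suc k)"] unfolding sweep_def
    by (metis m_assoc under_closed ascending_closed inv_closed s_closed)
qed

text \<open>Both sides reduce to the identity \<open>b a\<^sup>-\<^sup>2 b\<^sup>-\<^sup>1 = a\<^sup>-\<^sup>1 b\<^sup>-\<^sup>2 a\<close> for \<open>a = s k\<close> and \<open>b = s
  (k + 1)\<close>, which says that \<open>a b\<close> conjugates \<open>a\<close> to \<open>b\<close>.\<close>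

lemma sweep_conj:
  assumes "1 \<le> k" "Suc k < m"
  shows "s (Suc k) \<otimes> sweep k \<otimes> inv (s (Suc k)) = sweep (Suc k) \<otimes> inv (sweep k) \<otimes> sweep (k - 1)"
proof -
  obtain l where k: "k = Suc l" using assms by (cases k) auto
  let ?a = "s k" and ?b = "s (Suc k)" and ?g = "under l" and ?h = "ascending G s l"
  have g: "?b \<otimes> ?g = ?g \<otimes> ?b" using under_far[of l "Suc k"] assms k by simp
  have h: "inv ?h \<otimes> inv ?b = inv ?b \<otimes> inv ?h"
    using ascending_far[of l "Suc k"] assms k by (simp flip: inv_mult_group)
  have ab: "?a \<otimes> (?b \<otimes> ?a) = ?b \<otimes> (?a \<otimes> ?b)" using near[of k] assms by (simp add: m_assoc)
  have "?b \<otimes> inv ?a \<otimes> inv ?a \<otimes> inv ?b = inv ?a \<otimes> inv ?b \<otimes> inv ?b \<otimes> ?a"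
  proof -
    have "inv ?b \<otimes> (?a \<otimes> (?b \<otimes> ?a)) \<otimes> inv ?a = inv ?b \<otimes> (?b \<otimes> (?a \<otimes> ?b)) \<otimes> inv ?a"
      by (simp only: ab)
    then have *: "?a \<otimes> (?b \<otimes> inv ?a) = inv ?b \<otimes> (?a \<otimes> ?b)"
      by (simp add: free_group_simps)
    have "?a \<otimes> (?b \<otimes> inv ?a) \<otimes> inv ?a = inv ?b \<otimes> (?a \<otimes> (?b \<otimes> inv ?a))"
      by (subst *) (simp add: m_assoc)
    also have "\<dots> = inv ?b \<otimes> inv ?b \<otimes> ?a \<otimes> ?b" by (subst *) (simp add: m_assoc)
    finally have "inv ?a \<otimes> (?a \<otimes> (?b \<otimes> inv ?a) \<otimes> inv ?a) \<otimes> inv ?b = inv ?a \<otimes> (inv ?b \<otimes> inv ?b \<otimes> ?a \<otimes> ?b) \<otimes> inv ?b"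
      by simp
    then show ?thesis by (simp add: free_group_simps)
  qed
  note core = this
  have "?b \<otimes> sweep k \<otimes> inv ?b = (?b \<otimes> ?g) \<otimes> inv ?a \<otimes> inv ?a \<otimes> (inv ?h \<otimes> inv ?b)"
    by (simp add: sweep_def k under_simps free_group_simps)
  also have "\<dots> = ?g \<otimes> (?b \<otimes> inv ?a \<otimes> inv ?a \<otimes> inv ?b) \<otimes> inv ?h"
    unfolding g h by (simp add: free_group_simps)
  also have "\<dots> = sweep (Suc k) \<otimes> inv (sweep k) \<otimes> sweep (k - 1)"
    unfolding core by (simp add: sweep_def k under_simps free_group_simps)
  finally show ?thesis .
qed

text \<open>The first strand encircles the strands \<open>k + 2, \<dots>, m\<close>; the element is \<open>A\<^bsub>1,k+2\<^esub> \<cdots>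
  A\<^bsub>1,m\<^esub>\<close>, the braid that corresponds to the loop \<open>\<xi> k\<close>.\<close>

definition loop_around :: "nat \<Rightarrow> 'a" where
  "loop_around k = (if k < m then sweep k \<otimes> inv (sweep (m - 1)) else \<one>)"

lemma loop_around_closed [simp]: "loop_around k \<in> carrier G"
  by (simp add: loop_around_def)

lemma loop_around_one: "m - 1 \<le> k \<Longrightarrow> loop_around k = \<one>"
  by (cases "k = m - 1") (auto simp: loop_around_def)

lemma conj_hom: "g \<in> carrier G \<Longrightarrow> group_hom G G (\<lambda>x. g \<otimes> x \<otimes> inv g)"
  by unfold_locales (auto simp: hom_def free_group_simps)

lemma loop_around_conj_True:
  assumes "1 \<le> k" "Suc k < m"
  shows "s (Suc k) \<otimes> loop_around j \<otimes> inv (s (Suc k)) = hurwitz G k True loop_around j"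
proof -
  let ?c = "\<lambda>x. s (Suc k) \<otimes> x \<otimes> inv s (Suc k)"
  interpret c: group_hom G G ?c by (simp add: conj_hom)
  have E: "?c (sweep i) = sweep i" if "i < m" "i \<noteq> k" for i
    using sweep_commute[OF assms that] by (simp add: m_assoc)
  consider "j = k" | "j \<noteq> k" "j < m" | "m \<le> j" by linarith
  then show ?thesis
  proof cases
    case 1
    have "?c (loop_around k) = ?c (sweep k) \<otimes> inv ?c (sweep (m - 1))"
      using assms c.hom_mult[of "sweep k" "inv sweep (m - 1)"] c.hom_inv[of "sweep (m - 1)"]
      by (simp add: loop_around_def)
    also have "\<dots> = hurwitz G k True loop_around k"
      using assms E[of "m - 1"] sweep_conj[OF assms]
      by (simp add: hurwitz_def loop_around_def free_group_simps)
    finally show ?thesis using 1 by simp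
  next
    case 2
    have "?c (loop_around j) = ?c (sweep j) \<otimes> inv ?c (sweep (m - 1))"
      using 2 c.hom_mult[of "sweep j" "inv sweep (m - 1)"] c.hom_inv[of "sweep (m - 1)"]
      by (simp add: loop_around_def)
    then show ?thesis
      using 2 assms E[of "m - 1"] E[of j] by (simp add: hurwitz_def loop_around_def)
  next
    case 3
    then show ?thesis using assms by (simp add: loop_around_def hurwitz_def)
  qed
qed

text \<open>The other strands act on these loops by conjugation exactly as they act on
  assignments by Hurwitz moves. The case of a negative letter follows from that of a
  positive one, since the two moves are inverse to each other.\<close>

lemma loop_around_conj:
  assumes "1 \<le> k" "Suc k < m"
  shows "hurwitz G k b loop_around =
    (\<lambda>j. eval_letter G s (Suc k) b \<otimes> loop_around j \<otimes> inv (eval_letter G s (Suc k) b))"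
proof (cases b)
  case True
  then show ?thesis using loop_around_conj_True[OF assms] by (simp add: fun_eq_iff)
next
  case False
  let ?c = "\<lambda>x. inv s (Suc k) \<otimes> x \<otimes> inv (inv s (Suc k))"
  \<comment> \<open>The positive move undoes the inverse conjugation, by naturality of the moves.\<close>
  have "hurwitz G k True (\<lambda>j. ?c (loop_around j)) = (\<lambda>j. ?c (hurwitz G k True loop_around j))"
    by (intro hurwitz_hom conj_hom) auto
  also have "\<dots> = loop_around"
    by (simp add: free_group_simps flip: loop_around_conj_True[OF assms])
  finally show ?thesis
    using hurwitz_inverse[of "\<lambda>j. ?c (loop_around j)" k True] assms False by simp
qed

text \<open>Every braid is, up to moving the strand \<open>p\<close> to the front, the product of the loop
  that this strand describes and the braid formed by the other strands. Reading one
  letter from the left, a crossing of two other strands is carried past the winding of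
  the rest by conjugation, and a crossing of the strand itself contributes \<open>loop_around
  (i - 1) \<otimes> inv loop_around i\<close>, its inverse, or nothing.\<close>

lemma braid_decomposition:
  assumes "w \<in> words {1..<m}" "p \<in> {1..m}"
  shows "under (p - 1) \<otimes> eval_word G s w =
    winding G loop_around p w \<otimes> eval_word G (\<lambda>i. s (Suc i)) (delete_strand p w) \<otimes>
    under (track p w - 1)"
  using assms
proof (induction w arbitrary: p)
  case (Cons a w)
  obtain i b where a: "a = (i, b)" by force
  have i: "1 \<le> i" "i < m" "w \<in> words {1..<m}" using Cons.prems a by (auto simp: words_simps)
  let ?x = "eval_letter G s i b" and ?e = "eval_word G s w"
  let ?p = "track p [a]"
  let ?W = "winding G loop_around ?p w"
    and ?D = "eval_word G (\<lambda>i. s (Suc i)) (delete_strand ?p w)" and ?g = "under (track ?p w - 1)"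
  have x: "?x \<in> carrier G" and e: "?e \<in> carrier G" and W: "?W \<in> carrier G" and D: "?D \<in> carrier G"
    by (auto simp: eval_letter_closed winding_closed
      intro!: eval_word_closed[of UNIV] simp: words_def)
  have "?p \<in> {1..m}"
    using track_range[of "[a]" m p] Cons.prems a i by (simp add: words_simps del: track.simps)
  then have IH: "under (?p - 1) \<otimes> ?e = ?W \<otimes> ?D \<otimes> ?g" using Cons.IH i by blast
  have conj: "winding G (hurwitz G k b loop_around) q w =
      eval_letter G s (Suc k) b \<otimes> winding G loop_around q w \<otimes> inv (eval_letter G s (Suc k) b)"
    if "1 \<le> k" "Suc k < m" for k q
    unfolding loop_around_conj[OF that]
    by (rule winding_hom[OF conj_hom, symmetric]) (simp_all add: eval_letter_closed)
  have letter_commute: "under l \<otimes> eval_letter G s j b = eval_letter G s j' b \<otimes> under l"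
    if "under l \<otimes> s j = s j' \<otimes> under l" for l j j'
    using that inv_commute[of "under l" "s j" "s j'"] by (cases b) auto
  consider "p < i" | "p = i" | "p = Suc i" | "Suc i < p" by linarith
  then show ?case
  proof cases
    case 1
    then have "under (p - 1) \<otimes> ?x = ?x \<otimes> under (p - 1)"
      using Cons.prems i by (intro letter_commute under_far) auto
    then have "under (p - 1) \<otimes> (?x \<otimes> ?e) = ?x \<otimes> (under (p - 1) \<otimes> ?e)"
      using x e by (simp flip: m_assoc)
    moreover have "eval_letter G (\<lambda>i. s (Suc i)) (i - 1) b = ?x" using i by (cases b) auto
    ultimately show ?thesis
      using 1 IH conj[of "i - 1" p] Cons.prems i x e W D by (simp add: a free_group_simps)
  next
    case 2
    obtain l where l: "i = Suc l" using i by (cases i) auto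
    have W': "loop_around l \<otimes> inv loop_around i = under l \<otimes> (s i \<otimes> inv under i)"
      using i by (simp add: loop_around_def sweep_def l free_group_simps)
    have "under l \<otimes> ?x =
        (if b then loop_around l \<otimes> inv loop_around i else \<one>) \<otimes> under i"
      unfolding W' by (cases b) (simp_all add: l free_group_simps under_simps)
    then have "under l \<otimes> (?x \<otimes> ?e) =
        (if b then loop_around l \<otimes> inv loop_around i else \<one>) \<otimes> (under i \<otimes> ?e)"
      using x e by (simp flip: m_assoc)
    then show ?thesis
      using 2 IH i x e W D by (simp add: a m_assoc l)
  next
    case 3
    obtain l where l: "i = Suc l" using i by (cases i) auto
    have W': "loop_around i \<otimes> inv loop_around l = under i \<otimes> (inv s i \<otimes> inv under l)"
      using i by (simp add: loop_around_def sweep_def l free_group_simps)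
    have "under i \<otimes> ?x =
        (if b then \<one> else loop_around i \<otimes> inv loop_around l) \<otimes> under l"
      unfolding W' by (cases b) (simp_all add: l free_group_simps under_simps)
    then have "under i \<otimes> (?x \<otimes> ?e) =
        (if b then \<one> else loop_around i \<otimes> inv loop_around l) \<otimes> (under l \<otimes> ?e)"
      using x e by (simp flip: m_assoc)
    then show ?thesis
      using 3 IH i x e W D by (simp add: a m_assoc l)
  next
    case 4
    let ?y = "eval_letter G s (Suc i) b"
    have y: "?y \<in> carrier G" by (simp add: eval_letter_closed)
    have "under (p - 1) \<otimes> ?x = ?y \<otimes> under (p - 1)"
      using 4 Cons.prems i by (intro letter_commute under_shift) auto
    then have "under (p - 1) \<otimes> (?x \<otimes> ?e) = ?y \<otimes> (under (p - 1) \<otimes> ?e)"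
      using x e y by (simp flip: m_assoc)
    moreover have "eval_letter G (\<lambda>i. s (Suc i)) i b = ?y" by (cases b) auto
    ultimately show ?thesis
      using 4 IH conj[of i p] Cons.prems i x e W D y by (simp add: a free_group_simps)
  qed
qed simp

text \<open>The key to injectivity: a braid in which only the first strand moves is recovered
  from its winding.\<close>

lemma word_of_pure_loop:
  assumes "w \<in> words {1..<m}" "track 1 w = 1" "braid_eq (m - 1) (delete_strand 1 w) []" "1 \<le> m"
  shows "eval_word G s w = winding G loop_around 1 w"
proof -
  have far': "s (Suc i) \<otimes> s (Suc j) = s (Suc j) \<otimes> s (Suc i)"
    if "1 \<le> i" "i + 2 \<le> j" "j < m - 1" for i j
    using that by (intro far) auto
  have near': "s (Suc i) \<otimes> (s (Suc (Suc i)) \<otimes> s (Suc i)) =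
      s (Suc (Suc i)) \<otimes> (s (Suc i) \<otimes> s (Suc (Suc i)))"
    if "Suc i < m - 1" for i
    using near[of "Suc i"] that by (simp add: m_assoc)
  have "eval_word G (\<lambda>i. s (Suc i)) (delete_strand 1 w) = eval_word G (\<lambda>i. s (Suc i)) []"
    by (rule eval_word_pres_eq[OF _ _ assms(3)])
      (auto simp: braid_relations_def near' intro: far'[simplified])
  moreover have "eval_word G s w \<in> carrier G"
    using assms(1) by (auto intro: eval_word_closed)
  ultimately show ?thesis
    using braid_decomposition[of w 1] assms by (simp add: under_simps winding_closed)
qed

end


section \<open>Milnor's construction is a simplicial group\<close>

abbreviation map_word :: "('a \<Rightarrow> 'b) \<Rightarrow> 'a word \<Rightarrow> 'b word" where
  "map_word f \<equiv> map (\<lambda>(x, b). (f x, b))"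

lemma map_word_words: "f ` X \<subseteq> Y \<Longrightarrow> w \<in> words X \<Longrightarrow> map_word f w \<in> words Y"
  by (force simp: words_def)

lemma map_word_comp: "map_word f (map_word g w) = map_word (\<lambda>x. f (g x)) w"
  by (induction w) auto

lemma map_word_cong: "w \<in> words X \<Longrightarrow> (\<And>x. x \<in> X \<Longrightarrow> f x = g x) \<Longrightarrow> map_word f w = map_word g w"
  by (force simp: words_def)

lemma pres_eq_map_word:
  assumes "pres_eq X R v w" "f ` X \<subseteq> Y"
    and "\<And>l r. (l, r) \<in> R \<Longrightarrow> pres_eq Y S (map_word f l) (map_word f r)"
  shows "pres_eq Y S (map_word f v) (map_word f w)"
  using assms(1)
proof induction
  case (refl w)
  then show ?case using assms(2) by (intro pres_eq.refl map_word_words)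
next
  case (cancel x b)
  then show ?case using assms(2) pres_eq.cancel[of "f x" Y S b] by auto
qed (use assms(3) in \<open>auto intro: pres_eq.sym pres_eq.trans pres_eq.append\<close>)

lemma base_simplex_mem:
  assumes "pointed_simplicial_set K"
  shows "base_simplex K n \<in> simplices K n"
  using assms by (induction n) (auto simp: pointed_simplicial_set_def simplicial_def)

text \<open>The simplicial identities move \<open>d\<^sub>i\<close> past \<open>s\<^sub>0\<close> until it cancels against one of the
  \<open>s\<^sub>0\<close>. It follows that the face operators respect the relation of Milnor's
  construction.\<close>

lemma sface_base_simplex:
  assumes "pointed_simplicial_set K" "i \<le> Suc n"
  shows "sface K (Suc n) i (base_simplex K (Suc n)) = base_simplex K n"
  using assms(2)
proof (induction n arbitrary: i)
  case 0
  then show ?case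
    using assms(1) by (auto simp: pointed_simplicial_set_def simplicial_def le_Suc_eq)
next
  case (Suc n)
  have b: "base_simplex K (Suc n) \<in> simplices K (Suc n)" by (rule base_simplex_mem) fact
  show ?case
  proof (cases "i \<le> 1")
    case True
    then show ?thesis
      using assms(1) b by (auto simp: pointed_simplicial_set_def simplicial_def le_Suc_eq)
  next
    case False
    then have "sface K (Suc (Suc n)) i (sdegen K (Suc n) 0 (base_simplex K (Suc n))) =
        sdegen K n 0 (sface K (Suc n) (i - 1) (base_simplex K (Suc n)))"
      using assms(1) b Suc.prems unfolding pointed_simplicial_set_def simplicial_def
      by (metis One_nat_def diff_Suc_1 not_le)
    then show ?thesis using Suc.IH[of "i - 1"] Suc.prems by simp
  qed
qed

lemma sdegen_base_simplex:
  assumes "pointed_simplicial_set K" "i \<le> n"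
  shows "sdegen K n i (base_simplex K n) = base_simplex K (Suc n)"
  using assms(2)
proof (induction n arbitrary: i)
  case (Suc n)
  have b: "base_simplex K n \<in> simplices K n" by (rule base_simplex_mem) fact
  show ?case
  proof (cases i)
    case (Suc j)
    then have "sdegen K (Suc n) (Suc j) (sdegen K n 0 (base_simplex K n)) =
        sdegen K (Suc n) 0 (sdegen K n j (base_simplex K n))"
      using assms(1) b Suc.prems unfolding pointed_simplicial_set_def simplicial_def
      by (metis Suc_le_mono le0)
    then show ?thesis using Suc Suc.IH[of j] Suc.prems by simp
  qed simp
qed simp

lemma milnor_class_map:
  assumes "f ` simplices K n \<subseteq> simplices K k" "f (base_simplex K n) = base_simplex K k"
    and "base_simplex K k \<in> simplices K k" "w \<in> words (simplices K n)"
  shows "(\<Union>v\<in>milnor_class K n w. milnor_class K k (map_word f v)) = milnor_class K k (map_word f w)"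
  unfolding milnor_class_def
proof (intro UN_pres_class pres_class_eqI assms)
  fix v assume "pres_eq (simplices K n) (milnor_rel K n) w v"
  then have "pres_eq (simplices K k) (milnor_rel K k) (map_word f w) (map_word f v)"
    by (rule pres_eq_map_word[OF _ assms(1)])
      (use assms(2,3) in \<open>auto simp: milnor_rel_def words_simps intro!: pres_eq.relation\<close>)
  then show "pres_eq (simplices K k) (milnor_rel K k) (map_word f v) (map_word f w)"
    by (rule pres_eq.sym)
qed

lemma carrier_milnor_F:
  "carrier (grp (milnor_F K) n) = milnor_class K n ` words (simplices K n)"
  by (simp add: milnor_F_def carrier_pres_group milnor_class_def[abs_def])

lemma gface_milnor_F:
  assumes "pointed_simplicial_set K" "i \<le> Suc n" "w \<in> words (simplices K (Suc n))"
  shows "gface (milnor_F K) (Suc n) i (milnor_class K (Suc n) w) =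
    milnor_class K n (map_word (sface K (Suc n) i) w)"
proof -
  have "sface K (Suc n) i ` simplices K (Suc n) \<subseteq> simplices K n"
    using assms(1,2) by (auto simp: pointed_simplicial_set_def simplicial_def)
  then show ?thesis
    using assms milnor_class_map[of "sface K (Suc n) i" K "Suc n" n w]
    by (simp add: milnor_F_def sface_base_simplex base_simplex_mem del: base_simplex.simps)
qed

lemma gdegen_milnor_F:
  assumes "pointed_simplicial_set K" "i \<le> n" "w \<in> words (simplices K n)"
  shows "gdegen (milnor_F K) n i (milnor_class K n w) =
    milnor_class K (Suc n) (map_word (sdegen K n i) w)"
proof -
  have "sdegen K n i ` simplices K n \<subseteq> simplices K (Suc n)"
    using assms(1,2) by (auto simp: pointed_simplicial_set_def simplicial_def)
  then show ?thesis
    using assms milnor_class_map[of "sdegen K n i" K n "Suc n" w]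
    by (simp add: milnor_F_def sdegen_base_simplex base_simplex_mem del: base_simplex.simps)
qed

lemma group_milnor_F: "group (grp (milnor_F K) n)"
  by (simp add: milnor_F_def group_pres_group)

lemma mult_milnor_F:
  "v \<in> words (simplices K n) \<Longrightarrow> w \<in> words (simplices K n) \<Longrightarrow>
    milnor_class K n v \<otimes>\<^bsub>grp (milnor_F K) n\<^esub> milnor_class K n w = milnor_class K n (v @ w)"
  by (simp add: milnor_F_def milnor_class_def pres_class_mult)

text \<open>All operators act letter by letter, so that the identities hold because they hold
  for simplices.\<close>

lemma simplicial_group_milnor_F:
  assumes K: "pointed_simplicial_set K"
  shows "simplicial_group (milnor_F K)"
proof -
  have S: "simplicial (simplices K) (sface K) (sdegen K)"
    using K by (simp add: pointed_simplicial_set_def)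
  have fw: "map_word (sface K (Suc n) i) w \<in> words (simplices K n)"
    if "i \<le> Suc n" "w \<in> words (simplices K (Suc n))" for n i w
    using that S by (auto simp: simplicial_def intro!: map_word_words[of _ "simplices K (Suc n)"])
  have dw: "map_word (sdegen K n i) w \<in> words (simplices K (Suc n))"
    if "i \<le> n" "w \<in> words (simplices K n)" for n i w
    using that S by (auto simp: simplicial_def intro!: map_word_words[of _ "simplices K n"])
  have f: "gface (milnor_F K) (Suc n) i \<in> hom (grp (milnor_F K) (Suc n)) (grp (milnor_F K) n)"
    if "i \<le> Suc n" for n i
    using that
    by (auto simp: hom_def carrier_milnor_F mult_milnor_F gface_milnor_F[OF K] fw words_append)
  have d: "gdegen (milnor_F K) n i \<in> hom (grp (milnor_F K) n) (grp (milnor_F K) (Suc n))"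
    if "i \<le> n" for n i
    using that
    by (auto simp: hom_def carrier_milnor_F mult_milnor_F gdegen_milnor_F[OF K] dw words_append)
  note comp = gface_milnor_F[OF K] gdegen_milnor_F[OF K] fw dw map_word_comp
  have cong: "milnor_class K k (map_word f w) = milnor_class K k (map_word g w)"
    if "w \<in> words (simplices K n)" "\<And>x. x \<in> simplices K n \<Longrightarrow> f x = g x" for k n w f g
    by (rule arg_cong[OF map_word_cong[OF that]])
  have "simplicial (\<lambda>n. carrier (grp (milnor_F K) n)) (gface (milnor_F K)) (gdegen (milnor_F K))"
    unfolding simplicial_def carrier_milnor_F
  proof (intro conjI allI impI ballI)
    fix n i C assume "i \<le> Suc n" "C \<in> milnor_class K (Suc n) ` words (simplices K (Suc n))"
    then show "gface (milnor_F K) (Suc n) i C \<in> milnor_class K n ` words (simplices K n)"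
      by (auto simp: comp)
  next
    fix n i C assume "i \<le> n" "C \<in> milnor_class K n ` words (simplices K n)"
    then show "gdegen (milnor_F K) n i C \<in> milnor_class K (Suc n) ` words (simplices K (Suc n))"
      by (auto simp: comp)
  next
    fix n j i C assume "j \<le> Suc (Suc n)" "i < j"
      "C \<in> milnor_class K (Suc (Suc n)) ` words (simplices K (Suc (Suc n)))"
    then show "gface (milnor_F K) (Suc n) i (gface (milnor_F K) (Suc (Suc n)) j C) =
        gface (milnor_F K) (Suc n) (j - 1) (gface (milnor_F K) (Suc (Suc n)) i C)"
      using S by (clarsimp simp: comp simp del: map_map)
        (rule cong, assumption, simp add: simplicial_def)
  next
    fix n j i C assume *: "j \<le> n" "i < j" "C \<in> milnor_class K n ` words (simplices K n)"
    then obtain k where "n = Suc k" by (cases n) auto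
    with * show "gface (milnor_F K) (Suc n) i (gdegen (milnor_F K) n j C) =
        gdegen (milnor_F K) (n - 1) (j - 1) (gface (milnor_F K) n i C)"
      using S by (clarsimp simp: comp simp del: map_map)
        (rule cong, assumption, simp add: simplicial_def)
  next
    fix n j C assume *: "j \<le> n" "C \<in> milnor_class K n ` words (simplices K n)"
    then obtain w where w: "w \<in> words (simplices K n)" "C = milnor_class K n w" by blast
    have "map_word (\<lambda>x. sface K (Suc n) j (sdegen K n j x)) w = map_word (\<lambda>x. x) w"
      "map_word (\<lambda>x. sface K (Suc n) (Suc j) (sdegen K n j x)) w = map_word (\<lambda>x. x) w"
      by (rule map_word_cong[OF w(1)], use S *(1) in \<open>simp add: simplicial_def\<close>)+
    then show "gface (milnor_F K) (Suc n) j (gdegen (milnor_F K) n j C) = C"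
      "gface (milnor_F K) (Suc n) (Suc j) (gdegen (milnor_F K) n j C) = C"
      using * w by (simp_all add: comp del: map_map)
  next
    fix n i j C assume *: "i \<le> Suc n" "Suc j < i" "C \<in> milnor_class K n ` words (simplices K n)"
    then obtain k where "n = Suc k" by (cases n) auto
    with * show "gface (milnor_F K) (Suc n) i (gdegen (milnor_F K) n j C) =
        gdegen (milnor_F K) (n - 1) j (gface (milnor_F K) n (i - 1) C)"
      using S by (clarsimp simp: comp simp del: map_map)
        (rule cong, assumption, simp add: simplicial_def)
  next
    fix n j i C assume "j \<le> n" "i \<le> j" "C \<in> milnor_class K n ` words (simplices K n)"
    then show "gdegen (milnor_F K) (Suc n) i (gdegen (milnor_F K) n j C) =
        gdegen (milnor_F K) (Suc n) (Suc j) (gdegen (milnor_F K) n i C)"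
      using S by (clarsimp simp: comp simp del: map_map)
        (rule cong, assumption, simp add: simplicial_def)
  qed
  then show ?thesis
    using f d by (simp add: simplicial_group_def group_milnor_F)
qed

section \<open>Transport of structure\<close>

text \<open>The simplicial identities of \<open>G\<close>, and that its operators are homomorphisms, follow
  from \<open>H\<close> by injectivity of the \<open>\<phi> n\<close>. On braid words the degeneracies satisfy these
  identities only up to braid relations.\<close>

lemma simplicial_group_isomorphicI:
  assumes H: "simplicial_group H" and G: "\<And>n. group (grp G n)"
    and iso: "\<And>n. \<phi> n \<in> iso (grp G n) (grp H n)"
    and face_closed: "\<And>n i x. i \<le> Suc n \<Longrightarrow> x \<in> carrier (grp G (Suc n)) \<Longrightarrow>
      gface G (Suc n) i x \<in> carrier (grp G n)"
    and degen_closed: "\<And>n i x. i \<le> n \<Longrightarrow> x \<in> carrier (grp G n) \<Longrightarrow>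
      gdegen G n i x \<in> carrier (grp G (Suc n))"
    and face: "\<And>n i x. i \<le> Suc n \<Longrightarrow> x \<in> carrier (grp G (Suc n)) \<Longrightarrow>
      \<phi> n (gface G (Suc n) i x) = gface H (Suc n) i (\<phi> (Suc n) x)"
    and degen: "\<And>n i x. i \<le> n \<Longrightarrow> x \<in> carrier (grp G n) \<Longrightarrow>
      \<phi> (Suc n) (gdegen G n i x) = gdegen H n i (\<phi> n x)"
  shows "simplicial_group_isomorphic G H"
proof -
  have inj: "inj_on (\<phi> n) (carrier (grp G n))" for n
    using iso by (auto simp: iso_def bij_betw_def)
  have hom: "\<phi> n \<in> hom (grp G n) (grp H n)" for n
    using iso by (simp add: iso_def)
  have cl: "\<phi> n x \<in> carrier (grp H n)" if "x \<in> carrier (grp G n)" for n x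
    using hom that by (rule hom_in_carrier)
  have mult: "\<phi> n (x \<otimes>\<^bsub>grp G n\<^esub> y) = \<phi> n x \<otimes>\<^bsub>grp H n\<^esub> \<phi> n y"
    if "x \<in> carrier (grp G n)" "y \<in> carrier (grp G n)" for n x y
    using hom that by (rule hom_mult)
  have mcl: "x \<otimes>\<^bsub>grp G n\<^esub> y \<in> carrier (grp G n)"
    if "x \<in> carrier (grp G n)" "y \<in> carrier (grp G n)" for n x y
    using G[of n] that by (simp add: group.is_monoid monoid.m_closed)
  have S: "simplicial (\<lambda>n. carrier (grp H n)) (gface H) (gdegen H)"
    and Hf: "\<And>n i. i \<le> Suc n \<Longrightarrow> gface H (Suc n) i \<in> hom (grp H (Suc n)) (grp H n)"
    and Hd: "\<And>n i. i \<le> n \<Longrightarrow> gdegen H n i \<in> hom (grp H n) (grp H (Suc n))"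
    using H by (auto simp: simplicial_group_def)
  have eqI: "x = y" if "\<phi> n x = \<phi> n y" "x \<in> carrier (grp G n)" "y \<in> carrier (grp G n)" for n x y
    using inj that by (auto dest: inj_onD)
  note cls = cl mcl face_closed degen_closed
  have f: "gface G (Suc n) i \<in> hom (grp G (Suc n)) (grp G n)" if "i \<le> Suc n" for n i
    using that by (auto simp: cls intro!: homI)
      (auto simp: cls face mult hom_mult[OF Hf] intro!: eqI[of n])
  have d: "gdegen G n i \<in> hom (grp G n) (grp G (Suc n))" if "i \<le> n" for n i
    using that by (auto simp: cls intro!: homI)
      (auto simp: cls degen mult hom_mult[OF Hd] intro!: eqI[of "Suc n"])
  have "simplicial (\<lambda>n. carrier (grp G n)) (gface G) (gdegen G)"
    unfolding simplicial_def
  proof (intro conjI allI impI ballI)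
    fix n j i x assume *: "j \<le> Suc (Suc n)" "i < j" "x \<in> carrier (grp G (Suc (Suc n)))"
    show "gface G (Suc n) i (gface G (Suc (Suc n)) j x) =
        gface G (Suc n) (j - 1) (gface G (Suc (Suc n)) i x)"
      using S * by (intro eqI[of n]) (auto simp: face cls simplicial_def)
  next
    fix n j i x assume *: "j \<le> n" "i < j" "x \<in> carrier (grp G n)"
    then obtain k where "n = Suc k" by (cases n) auto
    then show "gface G (Suc n) i (gdegen G n j x) = gdegen G (n - 1) (j - 1) (gface G n i x)"
      using S * by (intro eqI[of n]) (auto simp: face degen cls simplicial_def)
  next
    fix n j x assume *: "j \<le> n" "x \<in> carrier (grp G n)"
    show "gface G (Suc n) j (gdegen G n j x) = x" "gface G (Suc n) (Suc j) (gdegen G n j x) = x"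
      using S * by (intro eqI[of n]; auto simp: face degen cls simplicial_def)+
  next
    fix n i j x assume *: "i \<le> Suc n" "Suc j < i" "x \<in> carrier (grp G n)"
    then obtain k where "n = Suc k" by (cases n) auto
    then show "gface G (Suc n) i (gdegen G n j x) = gdegen G (n - 1) j (gface G n (i - 1) x)"
      using S * by (intro eqI[of n]) (auto simp: face degen cls simplicial_def)
  next
    fix n j i x assume *: "j \<le> n" "i \<le> j" "x \<in> carrier (grp G n)"
    show "gdegen G (Suc n) i (gdegen G n j x) = gdegen G (Suc n) (Suc j) (gdegen G n i x)"
      using S * by (intro eqI[of "Suc (Suc n)"]) (auto simp: degen cls simplicial_def)
  qed (auto simp: cls)
  then have "simplicial_group G" using G f d by (simp add: simplicial_group_def)
  then show ?thesis
    unfolding simplicial_group_isomorphic_def using H iso face degen by blast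
qed


section \<open>The loop group of the pure braid groups\<close>

lemma braid_class_pres_class: "braid_class m = pres_class {1..<m} (braid_relations m)"
  by (simp add: braid_class_def[abs_def])

text \<open>The permutation of a word is the inverse of following its strands, and the latter
  depends only on the braid.\<close>

lemma word_perm_braid_eq:
  assumes "braid_eq m v w"
  shows "word_perm v = word_perm w"
proof
  fix x
  have "word_perm w (track (word_perm w x) w) = word_perm w x" by (rule word_perm_track)
  then have "track (word_perm w x) w = x"
    using word_perm_eq_iff by metis
  then have "track (word_perm w x) v = x" using track_braid_eq[OF assms] by simp
  then show "word_perm v x = word_perm w x" using word_perm_track by metis
qed

lemma braid_perm_class:
  assumes "w \<in> words {1..<m}"
  shows "braid_perm (braid_class m w) = word_perm w"
proof -
  have "word_perm ` braid_class m w = {word_perm w}"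
    using pres_class_self[OF assms, of "braid_relations m"]
    by (auto simp: braid_class_pres_class intro: word_perm_braid_eq[symmetric] simp del: One_nat_def)
  then show ?thesis by (simp add: braid_perm_def)
qed

text \<open>Words for the elements of the kernel of \<open>d\<^sub>0\<close> on pure braids: it is enough to ask
  that the first strand returns, because the others then return as well.\<close>

definition loop_words :: "nat \<Rightarrow> nat word set" where
  "loop_words m = {w \<in> words {1..<m}. track 1 w = 1 \<and> braid_eq (m - 1) (delete_strand 1 w) []}"

text \<open>Following a strand other than the first commutes with deleting the first strand,
  after which the braid is trivial.\<close>

lemma word_perm_loop_words:
  assumes "w \<in> loop_words m"
  shows "word_perm w = id"
proof -
  have w: "w \<in> words {1..<m}" "track 1 w = 1" "braid_eq (m - 1) (delete_strand 1 w) []"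
    using assms by (auto simp: loop_words_def)
  have "track p w = p" for p
  proof (cases p "1 :: nat" rule: linorder_cases)
    case less
    have "track 0 w = 0" using w(1) by (induction w) (auto simp: words_simps)
    then show ?thesis using less by simp
  next
    case equal
    then show ?thesis using w by simp
  next
    case greater
    have "p - 1 = after_delete 1 (track p w)"
      using track_delete_strand[of p 1 w] track_braid_eq[OF w(3)] greater w(2)
      by (simp add: after_delete_simps)
    moreover have "track p w \<noteq> 1" using track_eq_iff[of p w 1] w(2) greater by simp
    ultimately show ?thesis using greater by (auto simp: after_delete_def split: if_splits)
  qed
  then show ?thesis by (simp add: word_perm_eq_id_iff)
qed

lemma gface_AP:
  assumes "w \<in> words {1..<n + 2}" "t \<le> Suc n"
  shows "gface AP (Suc n) t (braid_class (n + 2) w) = braid_class (Suc n) (delete_strand (Suc t) w)"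
proof -
  have "braid_class (Suc n) (delete_strand (Suc t) v) = braid_class (Suc n) (delete_strand (Suc t) w)"
    if "braid_eq (n + 2) w v" for v
    using delete_strand_braid_eq[OF that, of "Suc t"] assms(2) unfolding braid_class_pres_class
    by (intro pres_class_eqI) (auto intro: pres_eq.sym)
  then show ?thesis
    using UN_pres_class[OF assms(1), of "braid_relations (n + 2)"
        "\<lambda>v. braid_class (Suc n) (delete_strand (Suc t) v)"]
    by (simp add: AP_def braid_class_pres_class[of "n + 2", simplified])
qed

lemma gdegen_AP:
  assumes "w \<in> words {1..<Suc n}"
  shows "gdegen AP n t (braid_class (Suc n) w) = braid_class (n + 2) (double_strand (Suc t) w)"
proof -
  have "braid_class (n + 2) (double_strand (Suc t) v) = braid_class (n + 2) (double_strand (Suc t) w)"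
    if "braid_eq (Suc n) w v" for v
    using double_strand_braid_eq[OF that, of "Suc t"] unfolding braid_class_pres_class
    by (intro pres_class_eqI) (auto intro: pres_eq.sym)
  then show ?thesis
    using UN_pres_class[OF assms(1), of "braid_relations (Suc n)"
        "\<lambda>v. braid_class (n + 2) (double_strand (Suc t) v)"]
    by (simp add: AP_def braid_class_pres_class[of "Suc n", simplified])
qed

abbreviation (input) loop_AP :: "nat word set sgroup" where
  "loop_AP \<equiv> loop_sgroup AP"

lemma one_pure_braid_group: "\<one>\<^bsub>pure_braid_group m\<^esub> = braid_class m []"
  by (simp add: pure_braid_group_def braid_group_def one_pres_group braid_class_pres_class)

lemma carrier_pure_braid_group:
  "carrier (pure_braid_group m) = braid_class m ` {w \<in> words {1..<m}. word_perm w = id}"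
proof -
  have "carrier (pure_braid_group m) =
      {C \<in> braid_class m ` words {1..<m}. braid_perm C = id}"
    by (simp add: pure_braid_group_def kernel_def braid_group_def carrier_pres_group
        sym_group_def braid_class_pres_class)
  also have "\<dots> = braid_class m ` {w \<in> words {1..<m}. word_perm w = id}"
    using braid_perm_class[of _ m] by (auto simp del: One_nat_def)
  finally show ?thesis .
qed

lemma carrier_loop_AP:
  "carrier (grp loop_AP n) = braid_class (n + 2) ` loop_words (n + 2)"
proof -
  have "carrier (grp loop_AP n) =
      {C \<in> carrier (pure_braid_group (n + 2)). gface AP (Suc n) 0 C = braid_class (Suc n) []}"
    by (simp add: loop_sgroup_def kernel_def one_pure_braid_group[symmetric]) (simp add: AP_def)
  also have "\<dots> = braid_class (n + 2) ` {w \<in> words {1..<n + 2}. word_perm w = id \<and>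
      gface AP (Suc n) 0 (braid_class (n + 2) w) = braid_class (Suc n) []}"
    unfolding carrier_pure_braid_group by blast
  also have "{w \<in> words {1..<n + 2}. word_perm w = id \<and>
      gface AP (Suc n) 0 (braid_class (n + 2) w) = braid_class (Suc n) []} = loop_words (n + 2)"
  proof -
    have "word_perm w = id \<and> gface AP (Suc n) 0 (braid_class (n + 2) w) = braid_class (Suc n) []
        \<longleftrightarrow> w \<in> loop_words (n + 2)" if "w \<in> words {1..<n + 2}" for w
    proof -
      have "gface AP (Suc n) 0 (braid_class (n + 2) w) = braid_class (Suc n) [] \<longleftrightarrow>
          braid_eq (Suc n) (delete_strand 1 w) []"
        using gface_AP[OF that, of 0] pres_class_eq_iff[of "[]" "{1..<Suc n}"]
        by (simp add: braid_class_pres_class words_Nil)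
      then show ?thesis
        using that word_perm_loop_words[of w "n + 2"] word_perm_eq_id_iff[of w]
        by (auto simp: loop_words_def)
    qed
    then show ?thesis by (auto simp: loop_words_def)
  qed
  finally show ?thesis .
qed

lemma grp_loop_AP:
  "grp loop_AP n = (braid_group (n + 2))\<lparr>carrier := braid_class (n + 2) ` loop_words (n + 2)\<rparr>"
proof -
  have "grp loop_AP n = (braid_group (n + 2))\<lparr>carrier := carrier (grp loop_AP n)\<rparr>"
    by (simp add: loop_sgroup_def AP_def pure_braid_group_def)
  then show ?thesis by (simp only: carrier_loop_AP)
qed

lemma group_braid_group: "group (braid_group m)"
  by (simp add: braid_group_def group_pres_group)

lemma mult_braid_group:
  "v \<in> words {1..<m} \<Longrightarrow> w \<in> words {1..<m} \<Longrightarrow>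
    braid_class m v \<otimes>\<^bsub>braid_group m\<^esub> braid_class m w = braid_class m (v @ w)"
  by (simp add: braid_group_def braid_class_pres_class pres_class_mult)

text \<open>The implication from left to right gives the closure under inverses: if \<open>v @ w\<close>
  represents the trivial braid, then the inverse of \<open>v\<close> is represented by a word of this
  kind.\<close>

lemma loop_words_append:
  assumes "v \<in> loop_words m" "w \<in> words {1..<m}" "1 \<le> m"
  shows "v @ w \<in> loop_words m \<longleftrightarrow> w \<in> loop_words m"
proof -
  have v: "v \<in> words {1..<m}" "track 1 v = 1" "braid_eq (m - 1) (delete_strand 1 v) []"
    using assms(1) by (auto simp: loop_words_def)
  have "delete_strand 1 w \<in> words {1..<m - 1}"
    using delete_strand_words[OF assms(2), of 1] assms(3) by simp
  then have "braid_eq (m - 1) (delete_strand 1 v @ delete_strand 1 w) ([] @ delete_strand 1 w)"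
    using v(3) by (intro pres_eq.append pres_eq.refl)
  then have "braid_eq (m - 1) (delete_strand 1 (v @ w)) [] \<longleftrightarrow> braid_eq (m - 1) (delete_strand 1 w) []"
    using v(2) unfolding delete_strand_append append_Nil
    by (auto intro: pres_eq.sym pres_eq.trans simp del: One_nat_def)
  then show ?thesis
    using v assms(2) unfolding loop_words_def by (simp add: track_append words_append)
qed

lemma subgroup_loop_AP: "subgroup (carrier (grp loop_AP n)) (braid_group (n + 2))"
proof -
  let ?m = "n + 2"
  interpret B: group "braid_group ?m" by (rule group_braid_group)
  have car: "carrier (braid_group ?m) = braid_class ?m ` words {1..<?m}"
    by (simp add: braid_group_def carrier_pres_group braid_class_pres_class)
  have nil: "[] \<in> loop_words ?m" by (simp add: loop_words_def words_Nil pres_eq.refl)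
  have one: "\<one>\<^bsub>braid_group ?m\<^esub> = braid_class ?m []"
    by (simp add: braid_group_def one_pres_group braid_class_pres_class)
  have W: "w \<in> words {1..<?m}" if "w \<in> loop_words ?m" for w using that by (simp add: loop_words_def)
  show ?thesis
    unfolding carrier_loop_AP
  proof (rule B.subgroupI)
    show "braid_class ?m ` loop_words ?m \<subseteq> carrier (braid_group ?m)"
      unfolding car using W by blast
    show "braid_class ?m ` loop_words ?m \<noteq> {}" using nil by blast
  next
    fix C assume "C \<in> braid_class ?m ` loop_words ?m"
    then obtain w where w: "w \<in> loop_words ?m" "C = braid_class ?m w" by blast
    then have C: "C \<in> carrier (braid_group ?m)" unfolding car using W by blast
    then obtain v where v: "v \<in> words {1..<?m}" "inv\<^bsub>braid_group ?m\<^esub> C = braid_class ?m v"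
      using B.inv_closed[OF C] unfolding car by blast
    have "braid_class ?m (w @ v) = \<one>\<^bsub>braid_group ?m\<^esub>"
      using B.r_inv[OF C] w(2) v mult_braid_group[OF W[OF w(1)] v(1)] by simp
    then have eq: "braid_eq ?m (w @ v) []"
      unfolding one braid_class_pres_class using pres_class_eq_iff words_Nil by metis
    have "braid_eq (?m - 1) (delete_strand 1 (w @ v)) (delete_strand 1 [])"
      by (rule delete_strand_braid_eq[OF eq]) simp
    then have "w @ v \<in> loop_words ?m"
      using track_braid_eq[OF eq, of 1] v(1) W[OF w(1)] unfolding loop_words_def
      by (simp add: words_append)
    then have "v \<in> loop_words ?m" using loop_words_append[OF w(1) v(1)] by simp
    then show "inv\<^bsub>braid_group ?m\<^esub> C \<in> braid_class ?m ` loop_words ?m" using v(2) by blast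
  next
    fix C D assume "C \<in> braid_class ?m ` loop_words ?m" "D \<in> braid_class ?m ` loop_words ?m"
    then obtain v w where "v \<in> loop_words ?m" "C = braid_class ?m v" "w \<in> loop_words ?m"
      "D = braid_class ?m w" by blast
    then show "C \<otimes>\<^bsub>braid_group ?m\<^esub> D \<in> braid_class ?m ` loop_words ?m"
      using mult_braid_group[of v ?m w] loop_words_append[of v ?m w] W by auto
  qed
qed

lemma group_loop_AP: "group (grp loop_AP n)"
  unfolding grp_loop_AP
  using subgroup_loop_AP[unfolded carrier_loop_AP] group_braid_group
  by (rule subgroup.subgroup_is_group)

lemma delete_strand_loop_words:
  assumes "w \<in> loop_words (Suc m)" "1 < q" "q \<le> Suc m"
  shows "delete_strand q w \<in> loop_words m"
proof -
  have w: "w \<in> words {1..<Suc m}" "track 1 w = 1" "braid_eq m (delete_strand 1 w) []"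
    using assms(1) by (auto simp: loop_words_def)
  have "braid_eq (m - 1) (delete_strand (q - 1) (delete_strand 1 w)) (delete_strand (q - 1) [])"
    using assms(2,3) by (intro delete_strand_braid_eq w(3)) auto
  moreover have "1 \<le> track q w"
    using track_range[OF w(1), of q] assms by simp
  ultimately show ?thesis
    using w(1) assms delete_strand_words[OF w(1), of q] delete_strand_commute[OF assms(2), of w]
      track_delete_strand[of 1 q w] w(2)
    by (simp add: loop_words_def after_delete_simps)
qed

lemma double_strand_loop_words:
  assumes "w \<in> loop_words m" "1 < q" "q \<le> m"
  shows "double_strand q w \<in> loop_words (Suc m)"
proof -
  have w: "w \<in> words {1..<m}" "track 1 w = 1" "braid_eq (m - 1) (delete_strand 1 w) []"
    using assms(1) by (auto simp: loop_words_def)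
  have "braid_eq m (double_strand (q - 1) (delete_strand 1 w)) (double_strand (q - 1) [])"
    using double_strand_braid_eq[OF w(3), of "q - 1"] assms by simp
  moreover have "1 \<le> track q w"
    using track_range[OF w(1), of q] assms by simp
  ultimately show ?thesis
    using w(1) assms double_strand_words[OF w(1), of q] delete_double_strand_commute[of 1 q w]
      track_double_strand[of 1 q w] w(2)
    by (simp add: loop_words_def after_delete_simps after_double_simps)
qed


section \<open>The isomorphism\<close>

abbreviation (input) F_Delta1 :: "nat list word set sgroup" where
  "F_Delta1 \<equiv> milnor_F Delta1"

text \<open>Truncating \<open>k\<close> at \<open>n + 1\<close> makes \<open>Delta1_simplex n k\<close> a simplex for every \<open>k\<close>, and
  the degenerate base point for all \<open>k > n\<close>, as assignments are indexed by all natural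
  numbers.\<close>

definition Delta1_simplex :: "nat \<Rightarrow> nat \<Rightarrow> nat list" where
  "Delta1_simplex n k = replicate (min k (Suc n)) 0 @ replicate (Suc n - k) 1"

text \<open>The universal assignment \<open>\<xi>\<close>: the classes for \<open>k \<le> n\<close> form a free basis, and the
  others are trivial.\<close>

definition vertex_class :: "nat \<Rightarrow> nat \<Rightarrow> nat list word set" where
  "vertex_class n k = milnor_class Delta1 n [(Delta1_simplex n k, True)]"

lemma simplices_Delta1: "simplices Delta1 n = Delta1_simplex n ` {..Suc n}"
  by (force simp: Delta1_def Delta1_simplex_def min_def)

lemma Delta1_simplex_mem: "Delta1_simplex n k \<in> simplices Delta1 n"
proof (cases "k \<le> Suc n")
  case False
  then have "Delta1_simplex n k = Delta1_simplex n (Suc n)" by (simp add: Delta1_simplex_def)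
  then show ?thesis by (simp add: simplices_Delta1)
qed (simp add: simplices_Delta1)

lemma count_Delta1_simplex: "count_list (Delta1_simplex n k) 0 = min k (Suc n)"
proof -
  have "count_list (replicate j (0 :: nat)) 0 = j" "count_list (replicate j (1 :: nat)) 0 = 0" for j
    by (induction j) auto
  then show ?thesis by (simp add: Delta1_simplex_def del: replicate_Suc)
qed

lemma sface_Delta1_simplex:
  "i \<le> Suc n \<Longrightarrow> sface Delta1 (Suc n) i (Delta1_simplex (Suc n) k) =
    Delta1_simplex n (if i < k then k - 1 else k)"
  by (auto simp: Delta1_def Delta1_simplex_def min_def nth_append simp del: replicate_Suc
      intro!: nth_equalityI)

lemma sdegen_Delta1_simplex:
  "i \<le> n \<Longrightarrow> sdegen Delta1 n i (Delta1_simplex n k) =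
    Delta1_simplex (Suc n) (if i < k then Suc k else k)"
  by (auto simp: Delta1_def Delta1_simplex_def min_def nth_append simp del: replicate_Suc
      intro!: nth_equalityI)

lemma base_simplex_Delta1: "base_simplex Delta1 n = Delta1_simplex n (Suc n)"
proof -
  have "base_simplex Delta1 n = replicate (Suc n) 0"
    by (induction n) (auto simp: Delta1_def)
  then show ?thesis by (simp add: Delta1_simplex_def)
qed

lemma word_vertex: "[(Delta1_simplex n k, b)] \<in> words (simplices Delta1 n)"
  by (simp add: words_simps Delta1_simplex_mem)

lemma vertex_class_closed: "vertex_class n k \<in> carrier (grp F_Delta1 n)"
  by (simp add: vertex_class_def carrier_milnor_F word_vertex)

lemma vertex_class_one: "Suc n \<le> k \<Longrightarrow> vertex_class n k = \<one>\<^bsub>grp F_Delta1 n\<^esub>"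
proof -
  assume "Suc n \<le> k"
  then have "Delta1_simplex n k = base_simplex Delta1 n"
    by (simp add: base_simplex_Delta1) (simp add: Delta1_simplex_def)
  then have "pres_eq (simplices Delta1 n) (milnor_rel Delta1 n) [(Delta1_simplex n k, True)] []"
    by (intro pres_eq.relation) (use word_vertex[of n k True] in \<open>auto simp: milnor_rel_def words_Nil\<close>)
  then show ?thesis
    unfolding vertex_class_def milnor_class_def
    by (simp add: milnor_F_def one_pres_group pres_class_eqI)
qed

definition loop_iso :: "nat \<Rightarrow> nat word set \<Rightarrow> nat list word set" where
  "loop_iso n C = winding (grp F_Delta1 n) (vertex_class n) 1 (SOME w. w \<in> C)"

lemma loop_iso_class:
  assumes "w \<in> words {1..<n + 2}"
  shows "loop_iso n (braid_class (n + 2) w) = winding (grp F_Delta1 n) (vertex_class n) 1 w"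
proof -
  have "braid_eq (n + 2) w (SOME v. v \<in> braid_class (n + 2) w)"
    using someI[of "\<lambda>v. v \<in> pres_class {1..<n + 2} (braid_relations (n + 2)) w",
        OF pres_class_self[OF assms]]
    unfolding braid_class_pres_class by (simp only: Image_singleton_iff mem_pres_class)
  then show ?thesis
    unfolding loop_iso_def
    by (intro group.winding_braid_eq[OF group_milnor_F, symmetric, of "n + 2"] vertex_class_closed)
      auto
qed

lemma loop_iso_hom: "loop_iso n \<in> hom (grp loop_AP n) (grp F_Delta1 n)"
proof (rule homI)
  interpret F: group "grp F_Delta1 n" by (rule group_milnor_F)
  fix C assume "C \<in> carrier (grp loop_AP n)"
  then obtain w where "w \<in> loop_words (n + 2)" "C = braid_class (n + 2) w"
    unfolding carrier_loop_AP by blast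
  then show "loop_iso n C \<in> carrier (grp F_Delta1 n)"
    using loop_iso_class[of w n]
    by (simp add: loop_words_def F.winding_closed vertex_class_closed)
  fix D assume "D \<in> carrier (grp loop_AP n)"
  then obtain v where v: "v \<in> loop_words (n + 2)" "D = braid_class (n + 2) v"
    unfolding carrier_loop_AP by blast
  let ?w = "winding (grp F_Delta1 n) (vertex_class n) 1"
  note w = \<open>w \<in> loop_words (n + 2)\<close> \<open>C = braid_class (n + 2) w\<close>
  have W: "w \<in> words {1..<n + 2}" "v \<in> words {1..<n + 2}" "track 1 w = 1"
    "braid_eq (Suc n) (delete_strand 1 w) []"
    using w(1) v(1) by (auto simp: loop_words_def)
  have "hurwitz_word (grp F_Delta1 n) (delete_strand 1 w) (vertex_class n) = vertex_class n"
    using F.hurwitz_word_braid_eq[OF W(4), of "vertex_class n"] vertex_class_closed by simp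
  then have "?w (w @ v) = ?w w \<otimes>\<^bsub>grp F_Delta1 n\<^esub> ?w v"
    using F.winding_append[of "vertex_class n" 1 w v] W(3) vertex_class_closed by simp
  moreover have "C \<otimes>\<^bsub>grp loop_AP n\<^esub> D = braid_class (n + 2) (w @ v)"
    unfolding grp_loop_AP w(2) v(2) using mult_braid_group[OF W(1,2)] by simp
  moreover have "w @ v \<in> words {1..<n + 2}" using W by (simp add: words_append)
  ultimately show "loop_iso n (C \<otimes>\<^bsub>grp loop_AP n\<^esub> D) =
      loop_iso n C \<otimes>\<^bsub>grp F_Delta1 n\<^esub> loop_iso n D"
    unfolding w(2) v(2) by (simp only: loop_iso_class W)
qed

lemma milnor_gface_hom:
  "i \<le> Suc n \<Longrightarrow> group_hom (grp F_Delta1 (Suc n)) (grp F_Delta1 n) (gface F_Delta1 (Suc n) i)"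
  using simplicial_group_milnor_F[OF pointed_simplicial_set_Delta1]
  by (auto simp: simplicial_group_def intro!: group_hom.intro group_hom_axioms.intro)

lemma milnor_gdegen_hom:
  "i \<le> n \<Longrightarrow> group_hom (grp F_Delta1 n) (grp F_Delta1 (Suc n)) (gdegen F_Delta1 n i)"
  using simplicial_group_milnor_F[OF pointed_simplicial_set_Delta1]
  by (auto simp: simplicial_group_def intro!: group_hom.intro group_hom_axioms.intro)

lemma gface_vertex_class:
  "i \<le> Suc n \<Longrightarrow> gface F_Delta1 (Suc n) i (vertex_class (Suc n) k) =
    vertex_class n (if i < k then k - 1 else k)"
  by (simp add: vertex_class_def gface_milnor_F[OF pointed_simplicial_set_Delta1] word_vertex
      sface_Delta1_simplex)

lemma gdegen_vertex_class:
  "i \<le> n \<Longrightarrow> gdegen F_Delta1 n i (vertex_class n k) =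
    vertex_class (Suc n) (if i < k then Suc k else k)"
  by (simp add: vertex_class_def gdegen_milnor_F[OF pointed_simplicial_set_Delta1] word_vertex
      sdegen_Delta1_simplex)

lemma gface_loop_AP:
  assumes "w \<in> loop_words (n + 3)" "i \<le> Suc n"
  shows "gface loop_AP (Suc n) i (braid_class (n + 3) w) =
    braid_class (n + 2) (delete_strand (i + 2) w)"
  using gface_AP[of w "Suc n" "Suc i"] assms
  by (simp add: loop_sgroup_def loop_words_def numeral_3_eq_3)

lemma gdegen_loop_AP:
  assumes "w \<in> loop_words (n + 2)" "i \<le> n"
  shows "gdegen loop_AP n i (braid_class (n + 2) w) =
    braid_class (n + 3) (double_strand (i + 2) w)"
  using gdegen_AP[of w "Suc n" "Suc i"] assms
  by (simp add: loop_sgroup_def loop_words_def numeral_3_eq_3)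

text \<open>The face operator on the free group turns \<open>vertex_class (n + 1)\<close> into the
  assignment that repeats the entry \<open>i\<close>, which is a trivial generator for the strand \<open>i
  + 2\<close>; deleting this strand omits the repeated entry.\<close>

lemma loop_iso_face:
  assumes "w \<in> loop_words (n + 3)" "i \<le> Suc n"
  shows "loop_iso n (braid_class (n + 2) (delete_strand (i + 2) w)) =
    gface F_Delta1 (Suc n) i (loop_iso (Suc n) (braid_class (n + 3) w))"
proof -
  let ?h = "gface F_Delta1 (Suc n) i"
  let ?\<xi> = "\<lambda>k. ?h (vertex_class (Suc n) k)"
  have w: "w \<in> words {1..<n + 3}" using assms(1) by (simp add: loop_words_def)
  have d: "delete_strand (i + 2) w \<in> words {1..<n + 2}"
    using delete_strand_words[OF w, of "i + 2"] assms(2) by simp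
  have v: "?\<xi> k = vertex_class n (if i < k then k - 1 else k)" for k
    by (rule gface_vertex_class[OF assms(2)])
  have om: "omit (Suc i) ?\<xi> = vertex_class n"
    unfolding v by (auto simp: omit_def fun_eq_iff)
  have "?h (loop_iso (Suc n) (braid_class (n + 3) w)) = ?h (winding (grp F_Delta1 (Suc n)) (vertex_class (Suc n)) 1 w)"
    using loop_iso_class[of w "Suc n"] w by (simp add: numeral_3_eq_3)
  also have "\<dots> = winding (grp F_Delta1 n) ?\<xi> 1 w"
    by (intro winding_hom milnor_gface_hom assms vertex_class_closed)
  also have "\<dots> = winding (grp F_Delta1 n) (vertex_class n) 1 (delete_strand (i + 2) w)"
    using group.winding_delete_strand[OF group_milnor_F, of ?\<xi> _ _ 1 "i + 2" w "n + 3"] w om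
    by (simp add: v vertex_class_closed after_delete_simps)
  also have "\<dots> = loop_iso n (braid_class (n + 2) (delete_strand (i + 2) w))"
    by (rule loop_iso_class[OF d, symmetric])
  finally show ?thesis by simp
qed

text \<open>The degeneracy operator on the free group turns \<open>vertex_class n\<close> into
  \<open>vertex_class (n + 1)\<close> without the entry \<open>i + 1\<close>, which is the assignment for a ribbon
  in place of the strand \<open>i + 2\<close>.\<close>

lemma loop_iso_degen:
  assumes "w \<in> loop_words (n + 2)" "i \<le> n"
  shows "loop_iso (Suc n) (braid_class (n + 3) (double_strand (i + 2) w)) =
    gdegen F_Delta1 n i (loop_iso n (braid_class (n + 2) w))"
proof -
  let ?h = "gdegen F_Delta1 n i"
  have w: "w \<in> words {1..<n + 2}" using assms(1) by (simp add: loop_words_def)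
  have d: "double_strand (i + 2) w \<in> words {1..<Suc n + 2}"
    using double_strand_words[OF w, of "i + 2"] by simp
  have om: "(\<lambda>k. ?h (vertex_class n k)) = omit (Suc i) (vertex_class (Suc n))"
    by (auto simp: gdegen_vertex_class[OF assms(2)] omit_def fun_eq_iff)
  have "?h (loop_iso n (braid_class (n + 2) w)) = ?h (winding (grp F_Delta1 n) (vertex_class n) 1 w)"
    by (simp only: loop_iso_class[OF w])
  also have "\<dots> = winding (grp F_Delta1 (Suc n)) (omit (Suc i) (vertex_class (Suc n))) 1 w"
    unfolding om[symmetric] by (intro winding_hom milnor_gdegen_hom assms vertex_class_closed)
  also have "\<dots> = winding (grp F_Delta1 (Suc n)) (vertex_class (Suc n)) 1 (double_strand (i + 2) w)"
    using group.winding_double_strand[OF group_milnor_F, of "vertex_class (Suc n)" Delta1 "Suc n" 1 "i + 2" w "n + 2"] w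
    by (simp add: vertex_class_closed after_delete_simps after_double_simps)
  also have "\<dots> = loop_iso (Suc n) (braid_class (n + 3) (double_strand (i + 2) w))"
    using loop_iso_class[OF d] by (simp add: numeral_3_eq_3)
  finally show ?thesis by simp
qed

text \<open>The value outside \<open>{1..<m}\<close> only serves to have an element of the group at every
  index.\<close>

definition sigma :: "nat \<Rightarrow> nat \<Rightarrow> nat word set" where
  "sigma m i = (if i \<in> {1..<m} then braid_class m [(i, True)] else \<one>\<^bsub>braid_group m\<^esub>)"

lemma braid_elements_sigma: "braid_elements (braid_group m) (sigma m) m"
proof -
  interpret group "braid_group m" by (rule group_braid_group)
  show ?thesis
  proof
    show "sigma m i \<in> carrier (braid_group m)" for i
      by (auto simp: sigma_def)
        (simp add: braid_group_def braid_class_pres_class pres_class_closed words_simps)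
    show "sigma m i \<otimes>\<^bsub>braid_group m\<^esub> sigma m j = sigma m j \<otimes>\<^bsub>braid_group m\<^esub> sigma m i"
      if "1 \<le> i" "i + 2 \<le> j" "j < m" for i j
      using that pres_class_eqI[OF far_relation[OF that], folded braid_class_def]
      by (simp add: sigma_def mult_braid_group words_simps)
    show "sigma m i \<otimes>\<^bsub>braid_group m\<^esub> sigma m (Suc i) \<otimes>\<^bsub>braid_group m\<^esub> sigma m i =
        sigma m (Suc i) \<otimes>\<^bsub>braid_group m\<^esub> sigma m i \<otimes>\<^bsub>braid_group m\<^esub> sigma m (Suc i)"
      if "1 \<le> i" "Suc i < m" for i
      using that pres_class_eqI[OF braid3[OF that], folded braid_class_def]
      by (simp add: sigma_def mult_braid_group words_simps)
  qed
qed

lemma eval_word_sigma: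
  "w \<in> words {1..<m} \<Longrightarrow> eval_word (braid_group m) (sigma m) w = braid_class m w"
  unfolding braid_group_def braid_class_pres_class
  by (rule eval_word_generators) (simp add: sigma_def braid_class_pres_class)

text \<open>Sending \<open>vertex_class n k\<close> to \<open>loop_around k\<close> defines a homomorphism from the free
  group, because \<open>loop_around (n + 1) = \<one>\<close>. By naturality it maps the winding of a word
  to the winding computed in the braid group, which is the braid itself. The index \<open>k\<close>
  of a simplex is the number of its vertices \<open>0\<close>.\<close>

lemma loop_iso_inj: "inj_on (loop_iso n) (carrier (grp loop_AP n))"
proof -
  let ?m = "n + 2"
  interpret B: braid_elements "braid_group ?m" "sigma ?m" ?m by (rule braid_elements_sigma)
  define f where "f = (\<lambda>x :: nat list. B.loop_around (count_list x 0))"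
  let ?\<psi> = "pres_lift (braid_group ?m) f"
  have f: "f x \<in> carrier (braid_group ?m)" for x by (simp only: f_def B.loop_around_closed)
  have f_simplex: "f (Delta1_simplex n k) = B.loop_around k" for k
  proof (cases "k \<le> Suc n")
    case True
    then show ?thesis by (simp add: f_def count_Delta1_simplex min_def)
  next
    case False
    then show ?thesis
      using B.loop_around_one[of k] B.loop_around_one[of "Suc n"]
      by (simp add: f_def count_Delta1_simplex min_def)
  qed
  have rel: "eval_word (braid_group ?m) f l = eval_word (braid_group ?m) f r"
    if "(l, r) \<in> milnor_rel Delta1 n" for l r
    using that B.loop_around_one[of "Suc n"] B.r_one[OF B.one_closed]
    by (simp add: milnor_rel_def base_simplex_Delta1 f_simplex)
  have hom: "group_hom (grp F_Delta1 n) (braid_group ?m) ?\<psi>"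
    unfolding group_hom_def group_hom_axioms_def
    using group_milnor_F B.is_group pres_lift_hom[OF B.is_group f rel]
    by (simp add: milnor_F_def)
  have vertex: "?\<psi> (vertex_class n k) = B.loop_around k" for k
    unfolding vertex_class_def milnor_class_def
    using pres_lift_class[OF B.is_group f rel word_vertex[of n k True]]
    by (simp only: eval_word.simps eval_letter.simps f_simplex B.r_one B.loop_around_closed)
  have "?\<psi> (loop_iso n (braid_class ?m w)) = braid_class ?m w" if "w \<in> loop_words ?m" for w
  proof -
    have w: "w \<in> words {1..<?m}" "track 1 w = 1" "braid_eq (?m - 1) (delete_strand 1 w) []"
      using that by (auto simp: loop_words_def)
    have "?\<psi> (loop_iso n (braid_class ?m w)) =
        ?\<psi> (winding (grp F_Delta1 n) (vertex_class n) 1 w)"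
      by (simp only: loop_iso_class[OF w(1)])
    also have "\<dots> = winding (braid_group ?m) (\<lambda>k. ?\<psi> (vertex_class n k)) 1 w"
      by (rule winding_hom[OF hom vertex_class_closed])
    also have "\<dots> = winding (braid_group ?m) B.loop_around 1 w"
      by (simp only: vertex)
    also have "\<dots> = eval_word (braid_group ?m) (sigma ?m) w"
      by (rule B.word_of_pure_loop[OF w, symmetric]) simp
    also have "\<dots> = braid_class ?m w"
      by (rule eval_word_sigma[OF w(1)])
    finally show ?thesis .
  qed
  then show ?thesis
    unfolding carrier_loop_AP by (intro inj_on_inverseI[of _ ?\<psi>]) auto
qed

text \<open>The first strand passes the next \<open>k\<close> strands on the side without contribution,
  passes the remaining ones on the other side, and returns without contribution. It
  represents \<open>loop_around k\<close>, in a form in which the deletion of the first strand leaves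
  the empty word.\<close>

definition circling_word :: "nat \<Rightarrow> nat \<Rightarrow> nat word" where
  "circling_word n k = map (\<lambda>i. (i, False)) [1..<Suc k] @ map (\<lambda>i. (i, True)) [Suc k..<n + 2] @
     map (\<lambda>i. (i, True)) (rev [1..<n + 2])"

lemma strand_ascending:
  assumes "p \<le> q"
  shows "delete_strand p (map (\<lambda>i. (i, b)) [p..<q]) = []"
    and "track p (map (\<lambda>i. (i, b)) [p..<q]) = q"
  using assms by (induction "q - p" arbitrary: p) (auto simp: upt_conv_Cons)

lemma strand_descending:
  assumes "p \<le> q"
  shows "delete_strand q (map (\<lambda>i. (i, b)) (rev [p..<q])) = []"
    and "track q (map (\<lambda>i. (i, b)) (rev [p..<q])) = p"
  using assms by (induction q rule: dec_induct) auto

lemma (in group) winding_monotone: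
  assumes "\<And>k. \<xi> k \<in> carrier G" "p \<le> q"
  shows "winding G \<xi> p (map (\<lambda>i. (i, False)) [p..<q]) = \<one>"
    and "winding G \<xi> q (map (\<lambda>i. (i, True)) (rev [p..<q])) = \<one>"
    and "1 \<le> p \<Longrightarrow> winding G \<xi> p (map (\<lambda>i. (i, True)) [p..<q]) = \<xi> (p - 1) \<otimes> inv \<xi> (q - 1)"
proof -
  show "winding G \<xi> p (map (\<lambda>i. (i, False)) [p..<q]) = \<one>"
    using assms(2) by (induction "q - p" arbitrary: p) (auto simp: upt_conv_Cons)
  show "winding G \<xi> q (map (\<lambda>i. (i, True)) (rev [p..<q])) = \<one>"
    using assms(2) by (induction q rule: dec_induct) auto
  show "winding G \<xi> p (map (\<lambda>i. (i, True)) [p..<q]) = \<xi> (p - 1) \<otimes> inv \<xi> (q - 1)" if "1 \<le> p"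
    using assms(2) that
    by (induction "q - p" arbitrary: p) (auto simp: upt_conv_Cons assms(1) free_group_simps)
qed

lemma circling_word:
  assumes "k \<le> Suc n"
  shows "circling_word n k \<in> loop_words (n + 2)"
    and "loop_iso n (braid_class (n + 2) (circling_word n k)) = vertex_class n k"
proof -
  interpret F: group "grp F_Delta1 n" by (rule group_milnor_F)
  let ?u = "map (\<lambda>i. (i, False)) [1..<Suc k]" and ?v = "map (\<lambda>i. (i, True)) [Suc k..<n + 2]"
    and ?w = "map (\<lambda>i. (i, True)) (rev [1..<n + 2])"
  have u: "delete_strand 1 ?u = []" "track 1 ?u = Suc k"
    and v: "delete_strand (Suc k) ?v = []" "track (Suc k) ?v = n + 2"
    and w: "delete_strand (n + 2) ?w = []" "track (n + 2) ?w = 1"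
    using assms by (intro strand_ascending strand_descending; simp)+
  have words: "circling_word n k \<in> words {1..<n + 2}"
    using assms by (auto simp: circling_word_def words_def)
  then show "circling_word n k \<in> loop_words (n + 2)"
    using u v w unfolding loop_words_def circling_word_def
    by (simp add: delete_strand_append track_append pres_eq.refl words_Nil del: upt_Suc)
  have "winding (grp F_Delta1 n) (vertex_class n) 1 ?u = \<one>\<^bsub>grp F_Delta1 n\<^esub>"
    "winding (grp F_Delta1 n) (vertex_class n) (n + 2) ?w = \<one>\<^bsub>grp F_Delta1 n\<^esub>"
    by (intro F.winding_monotone vertex_class_closed; simp)+
  moreover have "winding (grp F_Delta1 n) (vertex_class n) (Suc k) ?v = vertex_class n k"
    using F.winding_monotone(3)[of "vertex_class n" "Suc k" "n + 2"] assms
    by (simp add: vertex_class_closed vertex_class_one del: upt_Suc)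
  ultimately have "winding (grp F_Delta1 n) (vertex_class n) 1 (circling_word n k) = vertex_class n k"
    using u v w unfolding circling_word_def
    by (simp add: F.winding_append vertex_class_closed F.hurwitz_word_closed del: upt_Suc)
  then show "loop_iso n (braid_class (n + 2) (circling_word n k)) = vertex_class n k"
    using loop_iso_class[OF words] by simp
qed

lemma loop_iso_surj: "loop_iso n ` carrier (grp loop_AP n) = carrier (grp F_Delta1 n)"
proof -
  interpret group_hom "grp loop_AP n" "grp F_Delta1 n" "loop_iso n"
    by (intro group_hom.intro group_hom_axioms.intro group_loop_AP group_milnor_F loop_iso_hom)
  have "subgroup (loop_iso n ` carrier (grp loop_AP n)) (grp F_Delta1 n)"
    by (rule img_is_subgroup)
  moreover have "pres_class (simplices Delta1 n) (milnor_rel Delta1 n) [(x, True)]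
      \<in> loop_iso n ` carrier (grp loop_AP n)" if x: "x \<in> simplices Delta1 n" for x
  proof -
    obtain k where k: "k \<le> Suc n" "x = Delta1_simplex n k"
      using x by (auto simp: simplices_Delta1)
    have "vertex_class n k \<in> loop_iso n ` carrier (grp loop_AP n)"
      unfolding circling_word(2)[OF k(1), symmetric] carrier_loop_AP
      using circling_word(1)[OF k(1)] by blast
    then show ?thesis by (simp add: k(2) vertex_class_def milnor_class_def)
  qed
  ultimately show ?thesis
    using pres_group_generated[of "loop_iso n ` carrier (grp loop_AP n)" "simplices Delta1 n"
        "milnor_rel Delta1 n"] by (simp add: milnor_F_def)
qed

theorem theorem1p1:
  shows "simplicial_group_isomorphic (loop_sgroup AP) (milnor_F Delta1)"
proof (rule simplicial_group_isomorphicI[where \<phi> = loop_iso])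
  show "simplicial_group F_Delta1"
    by (rule simplicial_group_milnor_F[OF pointed_simplicial_set_Delta1])
  show "group (grp loop_AP n)" for n by (rule group_loop_AP)
  show "loop_iso n \<in> iso (grp loop_AP n) (grp F_Delta1 n)" for n
    using loop_iso_hom loop_iso_inj loop_iso_surj by (simp add: iso_def bij_betw_def)
next
  fix n i C assume i: "i \<le> Suc n" and "C \<in> carrier (grp loop_AP (Suc n))"
  then obtain w where w: "w \<in> loop_words (n + 3)" "C = braid_class (n + 3) w"
    unfolding carrier_loop_AP by (auto simp: numeral_3_eq_3)
  then show "loop_iso n (gface loop_AP (Suc n) i C) = gface F_Delta1 (Suc n) i (loop_iso (Suc n) C)"
    using i by (simp only: gface_loop_AP loop_iso_face)
  have "delete_strand (i + 2) w \<in> loop_words (n + 2)"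
    using w(1) i by (intro delete_strand_loop_words) (auto simp: numeral_3_eq_3)
  then show "gface loop_AP (Suc n) i C \<in> carrier (grp loop_AP n)"
    unfolding carrier_loop_AP w(2) gface_loop_AP[OF w(1) i] by (rule imageI)
next
  fix n i C assume i: "i \<le> n" and "C \<in> carrier (grp loop_AP n)"
  then obtain w where w: "w \<in> loop_words (n + 2)" "C = braid_class (n + 2) w"
    unfolding carrier_loop_AP by auto
  then show "loop_iso (Suc n) (gdegen loop_AP n i C) = gdegen F_Delta1 n i (loop_iso n C)"
    using i by (simp only: gdegen_loop_AP loop_iso_degen)
  have "double_strand (i + 2) w \<in> loop_words (n + 3)"
    using double_strand_loop_words[OF w(1), of "i + 2"] i by (simp add: numeral_3_eq_3)
  then show "gdegen loop_AP n i C \<in> carrier (grp loop_AP (Suc n))"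
    unfolding carrier_loop_AP w(2) gdegen_loop_AP[OF w(1) i] by (simp add: numeral_3_eq_3)
qed

end
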